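(* Let $G$ be a triangulation on $n$ vertices $v_1,\dots,v_n$ with $f^*$ as its outer face, realizable as a Delaunay triangulation where the points corresponding to vertices of $f^*$ lie on the outer face. Let $\mathcal{Q}$ be a solution of $\textsf{Const}(G)$ and $\beta\in\mathbb{R}^+$. Then there is a solution $\mathcal{P}$ of $\textsf{Const}(G)$, assigning a point set $P=\{\bar P_1,\dots,\bar P_n\}\subseteq\mathbb{R}^2$ to the vertices of $G$ ($\bar P_i$ to $v_i$), such that for each $v_i\in V(G)$ there is a disc $C_i$ with centre $\bar P_i$ and radius at least $\beta$ with the following property: for any $P'=\{\bar P'_i : \bar P'_i\in C_i,\ i\in[n]\}$, $\mathscr{DT}(P')$ is isomorphic to $\mathscr{DT}(P)$, and the points corresponding to vertices of $f^*$ lie on the outer face of $\mathscr{DT}(P')$.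
   Context: A triangulation is a plane graph in which every inner face is bounded by a cycle on three vertices. For finite $P\subseteq\mathbb{R}^2$, the Delaunay graph has vertex set $P$ and an edge $\{p,p'\}$ whenever some disc has boundary meeting $P$ exactly in $\{p,p'\}$ and interior containing no point of $P$; a Delaunay triangulation $\mathscr{DT}(P)$ is a triangulation obtained by adding edges to it; its outer face is bounded by the convex hull of $P$. $\textsf{Const}(G)$ is the following set of polynomial constraints: variables $X_i,Y_i$ for each $v_i$ (write $P_i=(X_i,Y_i)$) and $X_{ij},Y_{ij}$ for each edge $(v_i,v_j)$. With $\textsf{Con}((x_0,y_0),(x_1,y_1),(x_2,y_2))=x_2y_1-x_2y_0-x_0y_1-x_1y_2+x_1y_0+x_0y_2$ and $C^*$ the cycle bounding $f^*$ traversed clockwise, the constraints are: $\textsf{Con}(P_i,P_j,P_k)>0$ for each three consecutive $v_i,v_j,v_k$ on $C^*$; $\textsf{Con}(P_i,P_k,P_j)<0$ for each consecutive $v_i,v_j$ on $C^*$ and $v_k\in V(G)\setminus\{v_i,v_j\}$; and for each edge $(v_i,v_j)$: $X_i^2-X_j^2+Y_i^2-Y_j^2-2X_{ij}X_i-2Y_{ij}Y_i+2X_{ij}X_j+2Y_{ij}Y_j=0$ and, for each $k\in[n]\setminus\{i,j\}$, $X_k^2-X_i^2+Y_k^2-Y_i^2-2X_{ij}X_k-2Y_{ij}Y_k+2X_{ij}X_i+2Y_{ij}Y_i>0$. *)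

theory Defs
  imports "HOL-Complex_Analysis.Complex_Analysis"
begin

text \<open>
  The plane is \<^typ>\<open>complex\<close>. A plane graph is a finite simple graph together with a fixed
  embedding: each vertex is placed at a point and each edge (a two-element set of vertices) is
  drawn as an arc, recorded by its point set.
\<close>

record 'a plane_graph =
  verts :: "'a set"
  edges :: "'a set set"
  place :: "'a \<Rightarrow> complex"
  curve :: "'a set \<Rightarrow> complex set"

definition is_plane_graph :: "'a plane_graph \<Rightarrow> bool" where
  "is_plane_graph G \<longleftrightarrow>
     finite (verts G) \<and>
     (\<forall>e\<in>edges G. e \<subseteq> verts G \<and> card e = 2) \<and>
     inj_on (place G) (verts G) \<and>
     (\<forall>u v. {u, v} \<in> edges G \<longrightarrow>
        (\<exists>g. arc g \<and> pathstart g = place G u \<and> pathfinish g = place G v \<and>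
             path_image g = curve G {u, v})) \<and>
     (\<forall>e\<in>edges G. curve G e \<inter> place G ` verts G = place G ` e) \<and>
     (\<forall>e\<in>edges G. \<forall>e'\<in>edges G. e \<noteq> e' \<longrightarrow> curve G e \<inter> curve G e' \<subseteq> place G ` (e \<inter> e'))"

definition drawing :: "'a plane_graph \<Rightarrow> complex set" where
  "drawing G = place G ` verts G \<union> (\<Union>e\<in>edges G. curve G e)"

definition faces :: "'a plane_graph \<Rightarrow> complex set set" where
  "faces G = components (- drawing G)"

text \<open>
  The drawing is compact, so its complement has exactly one unbounded component, and this is
  its \<^const>\<open>outside\<close>.
\<close>

definition outer_face :: "'a plane_graph \<Rightarrow> complex set" where
  "outer_face G = outside (drawing G)"

definition outer_verts :: "'a plane_graph \<Rightarrow> 'a set" where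
  "outer_verts G = {v \<in> verts G. place G v \<in> frontier (outer_face G)}"

definition cyc_nth :: "'a list \<Rightarrow> nat \<Rightarrow> 'a" where
  "cyc_nth c i = c ! (i mod length c)"

definition cycle_edges :: "'a list \<Rightarrow> 'a set set" where
  "cycle_edges c = {{cyc_nth c i, cyc_nth c (i + 1)} | i. i < length c}"

definition is_cycle :: "'a plane_graph \<Rightarrow> 'a list \<Rightarrow> bool" where
  "is_cycle G c \<longleftrightarrow>
     length c \<ge> 3 \<and> distinct c \<and> set c \<subseteq> verts G \<and> cycle_edges c \<subseteq> edges G"

definition bounded_by_cycle :: "'a plane_graph \<Rightarrow> complex set \<Rightarrow> 'a list \<Rightarrow> bool" where
  "bounded_by_cycle G f c \<longleftrightarrow>
     is_cycle G c \<and> frontier f = (\<Union>e\<in>cycle_edges c. curve G e)"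

text \<open>
  The list \<open>c\<close> lists the cycle in clockwise order if some closed path runs through the edges of
  the cycle in this order and has winding number \<open>-1\<close> around the points that it encloses.
\<close>

definition clockwise_cycle :: "'a plane_graph \<Rightarrow> 'a list \<Rightarrow> bool" where
  "clockwise_cycle G c \<longleftrightarrow>
     (\<exists>g t. simple_path g \<and> pathfinish g = pathstart g \<and>
        t 0 = 0 \<and> t (length c) = 1 \<and>
        (\<forall>i<length c. t i < t (i + 1) \<and> g (t i) = place G (cyc_nth c i) \<and>
           g ` {t i..t (i + 1)} = curve G {cyc_nth c i, cyc_nth c (i + 1)}) \<and>
        (\<forall>z\<in>inside (path_image g). winding_number g z = -1))"

definition is_triangulation :: "'a plane_graph \<Rightarrow> bool" where
  "is_triangulation G \<longleftrightarrow>
     is_plane_graph G \<and>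
     (\<forall>f\<in>faces G. bounded f \<longrightarrow> (\<exists>c. length c = 3 \<and> bounded_by_cycle G f c))"

definition graph_iso :: "('a \<Rightarrow> 'b) \<Rightarrow> 'a plane_graph \<Rightarrow> 'b plane_graph \<Rightarrow> bool" where
  "graph_iso \<phi> G H \<longleftrightarrow>
     bij_betw \<phi> (verts G) (verts H) \<and>
     (\<forall>u\<in>verts G. \<forall>v\<in>verts G. {u, v} \<in> edges G \<longleftrightarrow> {\<phi> u, \<phi> v} \<in> edges H)"

definition isomorphic :: "'a plane_graph \<Rightarrow> 'b plane_graph \<Rightarrow> bool" where
  "isomorphic G H \<longleftrightarrow> (\<exists>\<phi>. graph_iso \<phi> G H)"

definition delaunay_edges :: "complex set \<Rightarrow> complex set set" where
  "delaunay_edges P =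
     {{p, q} | p q. p \<in> P \<and> q \<in> P \<and> p \<noteq> q \<and>
        (\<exists>c r. r > 0 \<and> sphere c r \<inter> P = {p, q} \<and> ball c r \<inter> P = {})}"

text \<open>The convex hull of a two-element set of points is the closed segment joining them.\<close>

definition straight_line_graph :: "complex set \<Rightarrow> complex set set \<Rightarrow> complex plane_graph" where
  "straight_line_graph P E =
     \<lparr>verts = P, edges = E, place = (\<lambda>p. p), curve = (\<lambda>e. convex hull e)\<rparr>"

text \<open>
  A point set need not have a unique Delaunay triangulation, hence the set of all of them.
\<close>

definition delaunay_triangulations :: "complex set \<Rightarrow> complex plane_graph set" where
  "delaunay_triangulations P =
     {T. \<exists>E. T = straight_line_graph P E \<and> delaunay_edges P \<subseteq> E \<and> is_triangulation T \<and>
         frontier (outer_face T) = frontier (convex hull P)}"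

definition delaunay_realizable_outer :: "'a plane_graph \<Rightarrow> bool" where
  "delaunay_realizable_outer G \<longleftrightarrow>
     (\<exists>P. finite P \<and>
       (\<exists>T\<in>delaunay_triangulations P. \<exists>\<phi>. graph_iso \<phi> G T \<and> \<phi> ` outer_verts G \<subseteq> outer_verts T))"

text \<open>
  An assignment of real values to the variables \<open>X\<^sub>i\<close>, \<open>Y\<^sub>i\<close> (one pair for each vertex) and
  \<open>X\<^sub>i\<^sub>j\<close>, \<open>Y\<^sub>i\<^sub>j\<close> (one pair for each undirected edge).
\<close>

record 'a assignment =
  vert_x :: "'a \<Rightarrow> real"
  vert_y :: "'a \<Rightarrow> real"
  edge_x :: "'a set \<Rightarrow> real"
  edge_y :: "'a set \<Rightarrow> real"

definition point :: "'a assignment \<Rightarrow> 'a \<Rightarrow> complex" where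
  "point S i = Complex (vert_x S i) (vert_y S i)"

text \<open>
  \<open>Con p\<^sub>0 p\<^sub>1 p\<^sub>2\<close> is positive iff \<open>p\<^sub>0\<close>, \<open>p\<^sub>1\<close>, \<open>p\<^sub>2\<close> make a clockwise (right) turn.
\<close>

definition Con :: "complex \<Rightarrow> complex \<Rightarrow> complex \<Rightarrow> real" where
  "Con p0 p1 p2 =
     Re p2 * Im p1 - Re p2 * Im p0 - Re p0 * Im p1 - Re p1 * Im p2 + Re p1 * Im p0 + Re p0 * Im p2"

text \<open>
  Here \<open>c\<close> lists the cycle bounding the outer face in clockwise order. The point
  \<open>(X\<^sub>i\<^sub>j, Y\<^sub>i\<^sub>j)\<close> is the centre of a circle through \<open>P\<^sub>i\<close> and \<open>P\<^sub>j\<close> with all other points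
  strictly outside.
\<close>

definition solves_Const :: "'a plane_graph \<Rightarrow> 'a list \<Rightarrow> 'a assignment \<Rightarrow> bool" where
  "solves_Const G c S \<longleftrightarrow>
     (\<forall>t<length c.
        Con (point S (cyc_nth c t)) (point S (cyc_nth c (t + 1))) (point S (cyc_nth c (t + 2))) > 0) \<and>
     (\<forall>t<length c. \<forall>k\<in>verts G - {cyc_nth c t, cyc_nth c (t + 1)}.
        Con (point S (cyc_nth c t)) (point S k) (point S (cyc_nth c (t + 1))) < 0) \<and>
     (\<forall>i j. {i, j} \<in> edges G \<longrightarrow>
        (vert_x S i)\<^sup>2 - (vert_x S j)\<^sup>2 + (vert_y S i)\<^sup>2 - (vert_y S j)\<^sup>2
          - 2 * edge_x S {i, j} * vert_x S i - 2 * edge_y S {i, j} * vert_y S i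
          + 2 * edge_x S {i, j} * vert_x S j + 2 * edge_y S {i, j} * vert_y S j = 0 \<and>
        (\<forall>k\<in>verts G - {i, j}.
           (vert_x S k)\<^sup>2 - (vert_x S i)\<^sup>2 + (vert_y S k)\<^sup>2 - (vert_y S i)\<^sup>2
             - 2 * edge_x S {i, j} * vert_x S k - 2 * edge_y S {i, j} * vert_y S k
             + 2 * edge_x S {i, j} * vert_x S i + 2 * edge_y S {i, j} * vert_y S i > 0))"

end

theory Submission
  imports Defs
begin

text \<open>
  A solution of the constraints stays a solution under scaling and, since the circle of an edge can
  be adjusted continuously, under small perturbations. Hence a solution that is scaled up far enough
  may be moved by \<open>\<beta>\<close> at each point, and it remains to see that the edges of any solution form the only
  Delaunay triangulation of its points.

  If \<open>G\<close> has \<open>n\<close> vertices and an outer cycle of length \<open>h\<close>, then it has at least \<open>3n - 3 - h\<close> edges: the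
  boundary cycles of its inner faces are linearly independent and orthogonal to the coboundaries, and
  each edge lies on two faces. Conversely, a straight-line plane graph on \<open>n\<close> points, \<open>h\<close> of which lie
  on the convex hull, has at most \<open>3n - 3 - h\<close> edges. The edges of a solution are Delaunay edges, so
  they do not cross each other, and no further straight edge can be added without a crossing. Since
  the edges of triangles with an empty circumcircle cross no Delaunay edge, all of them belong to the
  solution; these triangles cover the convex hull.
\<close>

subsection \<open>The number of edges of a triangulation\<close>

lemma underdetermined_system:
  fixes A :: "'i \<Rightarrow> 'j \<Rightarrow> 'a::field"
  assumes "finite J" "finite I" "card J < card I"
  shows "\<exists>x. (\<exists>i\<in>I. x i \<noteq> 0) \<and> (\<forall>j\<in>J. (\<Sum>i\<in>I. x i * A i j) = 0)"
  using assms
proof (induction J arbitrary: I A rule: finite_induct)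
  case empty
  then obtain i where "i \<in> I" by (metis card.empty card_gt_0_iff ex_in_conv)
  then show ?case by (intro exI[of _ "\<lambda>_. 1"]) auto
next
  case (insert j J)
  show ?case
  proof (cases "\<exists>i\<in>I. A i j \<noteq> 0")
    case False
    moreover obtain x where "\<exists>i\<in>I. x i \<noteq> 0" "\<forall>j\<in>J. (\<Sum>i\<in>I. x i * A i j) = 0"
      using insert.IH[of I A] insert.prems insert.hyps by auto
    ultimately show ?thesis by (intro exI[of _ x]) auto
  next
    case True
    then obtain p where p: "p \<in> I" "A p j \<noteq> 0" by blast
    define B where "B = (\<lambda>i k. A i k - A i j / A p j * A p k)"
    have "card J < card (I - {p})"
      using insert.prems insert.hyps p by (simp add: card_Diff_singleton)
    then obtain x where x: "\<exists>i\<in>I-{p}. x i \<noteq> 0" "\<forall>k\<in>J. (\<Sum>i\<in>I-{p}. x i * B i k) = 0"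
      using insert.IH[of "I - {p}" B] insert.prems by auto
    define y where "y = x(p := - (\<Sum>i\<in>I-{p}. x i * A i j) / A p j)"
    have split: "(\<Sum>i\<in>I. y i * A i k) = y p * A p k + (\<Sum>i\<in>I-{p}. x i * A i k)" for k
    proof -
      have "(\<Sum>i\<in>I-{p}. y i * A i k) = (\<Sum>i\<in>I-{p}. x i * A i k)"
        by (intro sum.cong) (auto simp: y_def)
      then show ?thesis using insert.prems p by (simp add: sum.remove[of I p])
    qed
    have "(\<Sum>i\<in>I. y i * A i j) = 0"
      using p by (simp add: split) (simp add: y_def)
    moreover have "(\<Sum>i\<in>I. y i * A i k) = 0" if "k \<in> J" for k
    proof -
      have "(\<Sum>i\<in>I-{p}. x i * B i k) = 
          (\<Sum>i\<in>I-{p}. x i * A i k) - (\<Sum>i\<in>I-{p}. x i * A i j) * (A p k / A p j)"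
        unfolding sum_distrib_right sum_subtractf[symmetric] B_def
        by (intro sum.cong) (auto simp: field_simps p)
      then show ?thesis using x(2) that by (simp add: split) (simp add: y_def field_simps)
    qed
    moreover have "\<exists>i\<in>I. y i \<noteq> 0" using x(1) by (auto simp: y_def)
    ultimately show ?thesis by (intro exI[of _ y]) auto
  qed
qed

lemma interior_arc_image_empty:
  fixes g :: "real \<Rightarrow> complex"
  assumes "arc g"
  shows "interior (path_image g) = {}"
proof (rule ccontr)
  assume "interior (path_image g) \<noteq> {}"
  then obtain z r where r: "r > 0" "ball z r \<subseteq> path_image g"
    by (meson ex_in_conv mem_interior)
  obtain h where h: "homeomorphism {0..1} (path_image g) g h"
    using assms homeomorphism_arc by blast
  define U where "U = ball z r"
  have Usub: "U \<subseteq> path_image g" using r by (simp add: U_def)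
  define p where "p = z + of_real (r/2)"
  have p: "p \<in> U" "z \<in> U" "p \<noteq> z" using r by (auto simp: p_def U_def dist_norm)
  have hinj: "inj_on h (path_image g)" using h
    by (metis homeomorphism_def inj_on_inverseI)
  have hcont: "continuous_on (path_image g) h" using h homeomorphism_def by blast
  define t where "t = (h p + h z) / 2"
  have "h p \<noteq> h z" using p hinj Usub by (metis inj_on_contraD subsetD)
  then have tne: "t \<noteq> h p" "t \<noteq> h z" by (auto simp: t_def field_simps)
  have between: "t \<in> S" if "connected S" "h p \<in> S" "h z \<in> S" for S
  proof (cases "h p \<le> h z")
    case True
    then have "t \<in> {h p..h z}" by (simp add: t_def)
    then show ?thesis using connected_contains_Icc[OF that] by blast
  next
    case False
    then have "t \<in> {h z..h p}" by (simp add: t_def)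
    then show ?thesis using connected_contains_Icc[OF that(1,3,2)] by blast
  qed
  have "connected (h ` U)"
    by (intro connected_continuous_image continuous_on_subset[OF hcont] Usub) (simp add: U_def)
  then have "t \<in> h ` U"
    by (rule between) (use p in auto)
  then obtain w where w: "w \<in> U" "h w = t" by auto
  have "connected (U - {w})"
    by (rule connected_open_delete) (auto simp: U_def)
  then have "connected (h ` (U - {w}))"
    using Usub by (intro connected_continuous_image continuous_on_subset[OF hcont]) auto
  moreover have "p \<noteq> w" "z \<noteq> w" using tne w by auto
  ultimately have "t \<in> h ` (U - {w})"
    by (intro between) (use p in auto)
  then obtain w' where "w' \<in> U" "w' \<noteq> w" "h w' = t" by auto
  then show False using w Usub inj_onD[OF hinj, of w' w] by auto
qed

lemma interior_Union_closed_empty: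
  assumes "finite F" "\<And>S. S \<in> F \<Longrightarrow> closed S" "\<And>S. S \<in> F \<Longrightarrow> interior S = {}"
  shows "interior (\<Union>F) = {}"
  using assms
proof (induction F rule: finite_induct)
  case (insert S F)
  then show ?case
    by (simp add: interior_closed_Un_empty_interior)
qed auto

locale cycle_bounded_triangulation =
  fixes G :: "'a::linorder plane_graph" and C :: "'a list"
  assumes tri: "is_triangulation G"
    and outer: "bounded_by_cycle G (outer_face G) C"
    and cw: "clockwise_cycle G C"
begin

lemma plane: "is_plane_graph G"
  using tri by (simp add: is_triangulation_def)

lemma finite_verts: "finite (verts G)"
  using plane by (simp add: is_plane_graph_def)

lemma inj_place: "inj_on (place G) (verts G)"
  using plane by (simp add: is_plane_graph_def)

lemma edge_subset: "e \<in> edges G \<Longrightarrow> e \<subseteq> verts G"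
  using plane by (simp add: is_plane_graph_def)

lemma edge_card: "e \<in> edges G \<Longrightarrow> card e = 2"
  using plane by (simp add: is_plane_graph_def)

lemma edgeE:
  assumes "e \<in> edges G"
  obtains u v where "u < v" "e = {u, v}" "u \<in> verts G" "v \<in> verts G"
proof -
  obtain x y where xy: "e = {x, y}" "x \<noteq> y" using edge_card[OF assms] by (meson card_2_iff)
  have V: "x \<in> verts G" "y \<in> verts G" using edge_subset[OF assms] xy by auto
  show ?thesis
  proof (cases "x < y")
    case True
    show ?thesis by (rule that[OF True xy(1) V])
  next
    case False
    then have "y < x" using xy by auto
    moreover have "e = {y, x}" using xy by auto
    ultimately show ?thesis by (rule that) (use V in auto)
  qed
qed

lemma finite_edges: "finite (edges G)"
  by (rule finite_subset[of _ "Pow (verts G)"]) (use edge_subset finite_verts in auto)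

lemma curve_place: "e \<in> edges G \<Longrightarrow> curve G e \<inter> place G ` verts G = place G ` e"
  using plane by (simp add: is_plane_graph_def)

lemma curve_inter:
  "e \<in> edges G \<Longrightarrow> e' \<in> edges G \<Longrightarrow> e \<noteq> e' \<Longrightarrow> curve G e \<inter> curve G e' \<subseteq> place G ` (e \<inter> e')"
  using plane by (simp add: is_plane_graph_def)

definition epath :: "'a set \<Rightarrow> real \<Rightarrow> complex" where
  "epath e = (SOME g. arc g \<and> pathstart g = place G (Min e) \<and> pathfinish g = place G (Max e) \<and>
     path_image g = curve G e)"

lemma epath:
  assumes "{u, v} \<in> edges G" "u < v"
  shows "arc (epath {u, v})" "pathstart (epath {u, v}) = place G u"
    "pathfinish (epath {u, v}) = place G v" "path_image (epath {u, v}) = curve G {u, v}"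
proof -
  have "\<forall>u v. {u, v} \<in> edges G \<longrightarrow> (\<exists>g. arc g \<and> pathstart g = place G u \<and>
     pathfinish g = place G v \<and> path_image g = curve G {u, v})"
    using plane unfolding is_plane_graph_def by (elim conjE)
  then have "\<exists>g. arc g \<and> pathstart g = place G u \<and> pathfinish g = place G v \<and>
             path_image g = curve G {u, v}"
    using assms(1) by (elim allE impE)
  then have ex: "\<exists>g. arc g \<and> pathstart g = place G (Min {u, v}) \<and> pathfinish g = place G (Max {u, v}) \<and>
     path_image g = curve G {u, v}"
    using assms by simp
  have "arc (epath {u, v}) \<and> pathstart (epath {u, v}) = place G (Min {u, v}) \<and>
      pathfinish (epath {u, v}) = place G (Max {u, v}) \<and> path_image (epath {u, v}) = curve G {u, v}"
    unfolding epath_def by (rule someI_ex[OF ex])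
  moreover have "Min {u, v} = u" "Max {u, v} = v" using assms by auto
  ultimately show "arc (epath {u, v})" "pathstart (epath {u, v}) = place G u"
    "pathfinish (epath {u, v}) = place G v" "path_image (epath {u, v}) = curve G {u, v}"
    by simp_all
qed

lemma compact_curve: "compact (curve G e)" and interior_curve: "interior (curve G e) = {}"
  if e: "e \<in> edges G"
proof -
  obtain u v where uv: "u < v" "e = {u, v}" by (rule edgeE[OF e])
  have "arc (epath e)" "path_image (epath e) = curve G e"
    using epath(1)[of u v] epath(4)[of u v] e uv by auto
  then show "compact (curve G e)" "interior (curve G e) = {}"
    using interior_arc_image_empty[of "epath e"] compact_path_image[of "epath e"] arc_imp_path[of "epath e"]
    by simp_all
qed

lemma compact_drawing: "compact (drawing G)"
proof -
  have "compact (place G ` verts G)" using finite_verts by (simp add: finite_imp_compact)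
  moreover have "compact (\<Union>e\<in>edges G. curve G e)"
    using finite_edges compact_curve by (intro compact_UN) auto
  ultimately show ?thesis unfolding drawing_def by (rule compact_Un)
qed

lemma interior_drawing: "interior (drawing G) = {}"
proof -
  have "closed (place G ` verts G)" "interior (place G ` verts G) = {}"
    using finite_verts by (simp_all add: finite_imp_closed empty_interior_finite)
  moreover have "interior (\<Union>(curve G ` edges G)) = {}"
    using finite_edges compact_curve interior_curve
    by (intro interior_Union_closed_empty) (auto simp: compact_imp_closed)
  ultimately show ?thesis
    unfolding drawing_def by (simp add: interior_closed_Un_empty_interior)
qed

lemma faceD:
  assumes "f \<in> faces G"
  shows "connected f" "open f" "f \<noteq> {}" "f \<inter> drawing G = {}"
proof -
  have "open (- drawing G)" using compact_drawing by (simp add: compact_imp_closed open_Compl)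
  moreover have comp: "f \<in> components (- drawing G)" using assms by (simp add: faces_def)
  ultimately show "open f" by (rule open_components)
  show "connected f" by (rule in_components_connected[OF comp])
  show "f \<noteq> {}" by (rule in_components_nonempty[OF comp])
  show "f \<inter> drawing G = {}" using in_components_subset[OF comp] by auto
qed

lemma face_disjoint: "f \<in> faces G \<Longrightarrow> g \<in> faces G \<Longrightarrow> f \<noteq> g \<Longrightarrow> f \<inter> g = {}"
  unfolding faces_def by (simp add: components_nonoverlap)

lemma face_bounded_or_outer:
  assumes "f \<in> faces G" "\<not> bounded f"
  shows "f = outer_face G"
proof -
  obtain x where x: "x \<in> - drawing G" "f = connected_component_set (- drawing G) x"
    using assms unfolding faces_def components_def by auto
  have xo: "x \<in> outside (drawing G)"
    using x assms(2) by (simp add: outside_def)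
  have "y \<in> outside (drawing G)" if "y \<in> f" for y
  proof -
    have "connected_component_set (- drawing G) y = f"
      using that connected_component_eq[of y "- drawing G" x] x(2) by auto
    moreover have "y \<notin> drawing G" using that faceD(4)[OF assms(1)] by auto
    ultimately show ?thesis using assms(2) by (simp add: outside_def)
  qed
  then have "f \<subseteq> outside (drawing G)" by auto
  moreover have "outside (drawing G) \<subseteq> f"
    unfolding x(2)
    by (rule connected_component_maximal[OF xo connected_outside])
       (use compact_drawing in \<open>auto simp: compact_imp_bounded outside_def\<close>)
  ultimately show ?thesis by (simp add: outer_face_def)
qed

lemma face_eq_inside:
  assumes f: "f \<in> faces G" "bounded f"
    and \<gamma>: "simple_path \<gamma>" "pathfinish \<gamma> = pathstart \<gamma>" "frontier f = path_image \<gamma>"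
  shows "f = inside (path_image \<gamma>)"
proof -
  note J = Jordan_inside_outside[OF \<gamma>(1,2)]
  have disj: "f \<inter> path_image \<gamma> = {}"
    using faceD(2)[OF f(1)] \<gamma>(3) by (simp add: frontier_disjoint_eq[symmetric] inf_commute)
  have A: "f = S" if S: "connected S" "f \<inter> S \<noteq> {}" "S \<inter> path_image \<gamma> = {}" "frontier S = path_image \<gamma>" for S
  proof
    show "S \<subseteq> f" using connected_Int_frontier[OF S(1), of f] S \<gamma>(3) by auto
    show "f \<subseteq> S" using connected_Int_frontier[OF faceD(1)[OF f(1)], of S] S disj by auto
  qed
  have "f \<noteq> outside (path_image \<gamma>)" using J f(2) by auto
  then have "f \<inter> outside (path_image \<gamma>) = {}"
    using A[of "outside (path_image \<gamma>)"] J outside_no_overlap[of "path_image \<gamma>"] by auto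
  moreover have "f \<subseteq> inside (path_image \<gamma>) \<union> outside (path_image \<gamma>)"
    using disj J by auto
  ultimately have "f \<inter> inside (path_image \<gamma>) \<noteq> {}"
    using faceD(3)[OF f(1)] by blast
  then show ?thesis
    using A[of "inside (path_image \<gamma>)"] J inside_no_overlap[of "path_image \<gamma>"] by auto
qed

end

lemma cycle_edges_3: "cycle_edges [p, q, r] = {{p, q}, {q, r}, {r, p}}"
proof -
  have "i < length [p, q, r] \<longleftrightarrow> i = 0 \<or> i = 1 \<or> i = 2" for i by auto
  then have "cycle_edges [p, q, r] = {{cyc_nth [p, q, r] i, cyc_nth [p, q, r] (i + 1)} |i. i = 0 \<or> i = 1 \<or> i = 2}"
    unfolding cycle_edges_def by presburger
  also have "\<dots> = {{cyc_nth [p,q,r] 0, cyc_nth [p,q,r] 1}, {cyc_nth [p,q,r] 1, cyc_nth [p,q,r] 2}, {cyc_nth [p,q,r] 2, cyc_nth [p,q,r] 3}}"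
    by (auto simp: numeral_2_eq_2 numeral_3_eq_3)
  also have "\<dots> = {{p, q}, {q, r}, {r, p}}"
    by (simp add: cyc_nth_def)
  finally show ?thesis .
qed

lemma sorted_triple:
  fixes p q r :: "'a::linorder"
  assumes "p \<noteq> q" "q \<noteq> r" "r \<noteq> p"
  obtains a b d where "a < b" "b < d" "{{p, q}, {q, r}, {r, p}} = {{a, b}, {b, d}, {a, d}}"
proof -
  have *: thesis if "x < y" "y < z" "{{p, q}, {q, r}, {r, p}} = {{x, y}, {y, z}, {x, z}}" for x y z
    using \<open>\<And>b a d. a < b \<Longrightarrow> b < d \<Longrightarrow> {{p, q}, {q, r}, {r, p}} = {{a, b}, {b, d}, {a, d}} \<Longrightarrow> thesis\<close> that by blast
  consider "p < q" "q < r" | "p < r" "r < q" | "q < p" "p < r" | "q < r" "r < p" | "r < p" "p < q" | "r < q" "q < p"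
    using assms by (metis linorder_neqE)
  then show thesis
    by cases (rule *, assumption, assumption, simp add: insert_commute)+
qed

context cycle_bounded_triangulation
begin

definition triangle_path :: "'a \<Rightarrow> 'a \<Rightarrow> 'a \<Rightarrow> real \<Rightarrow> complex" where
  "triangle_path a b d = (epath {a, b} +++ epath {b, d}) +++ reversepath (epath {a, d})"

definition triangle :: "'a \<Rightarrow> 'a \<Rightarrow> 'a \<Rightarrow> bool" where
  "triangle a b d \<longleftrightarrow> a < b \<and> b < d \<and> {a, b} \<in> edges G \<and> {b, d} \<in> edges G \<and> {a, d} \<in> edges G"

lemma triangle_path:
  assumes "triangle a b d"
  shows "simple_path (triangle_path a b d)"
    "pathfinish (triangle_path a b d) = pathstart (triangle_path a b d)"
    "path_image (triangle_path a b d) = (\<Union>e\<in>{{a, b}, {b, d}, {a, d}}. curve G e)"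
proof -
  have o: "a < b" "b < d" "a < d" and e: "{a, b} \<in> edges G" "{b, d} \<in> edges G" "{a, d} \<in> edges G"
    using assms by (auto simp: triangle_def)
  note ab = epath[OF e(1) o(1)] and bd = epath[OF e(2) o(2)] and ad = epath[OF e(3) o(3)]
  have i: "{a, b} \<inter> {b, d} = {b}" "{a, b} \<inter> {a, d} = {a}" "{b, d} \<inter> {a, d} = {d}"
    using o by auto
  then have ne: "{a, b} \<noteq> {b, d}" "{a, b} \<noteq> {a, d}" "{b, d} \<noteq> {a, d}"
    using o by (auto simp: doubleton_eq_iff)
  have x: "curve G {a, b} \<inter> curve G {b, d} \<subseteq> {place G b}" "curve G {a, b} \<inter> curve G {a, d} \<subseteq> {place G a}"
     "curve G {b, d} \<inter> curve G {a, d} \<subseteq> {place G d}"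
    using curve_inter[OF e(1,2) ne(1)] curve_inter[OF e(1,3) ne(2)] curve_inter[OF e(2,3) ne(3)]
    unfolding i by simp_all
  have arc: "arc (epath {a, b} +++ epath {b, d})"
    using ab bd x by (intro arc_join) auto
  have img: "path_image (epath {a, b} +++ epath {b, d}) = curve G {a, b} \<union> curve G {b, d}"
    using ab bd by (subst path_image_join) auto
  show "simple_path (triangle_path a b d)"
    unfolding triangle_path_def
    by (rule simple_path_join_loop) (use arc ab bd ad x img in \<open>auto intro: arc_reversepath\<close>)
  show "pathfinish (triangle_path a b d) = pathstart (triangle_path a b d)"
    using ab bd ad by (simp add: triangle_path_def)
  show "path_image (triangle_path a b d) = (\<Union>e\<in>{{a, b}, {b, d}, {a, d}}. curve G e)"
    unfolding triangle_path_def using ab bd ad img by (subst path_image_join) auto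
qed

lemma bounded_face_triangle:
  assumes "f \<in> faces G" "bounded f"
  obtains a b d where "triangle a b d" "frontier f = (\<Union>e\<in>{{a, b}, {b, d}, {a, d}}. curve G e)"
    "f = inside (path_image (triangle_path a b d))"
proof -
  obtain c where c: "length c = 3" "bounded_by_cycle G f c"
    using tri assms unfolding is_triangulation_def by blast
  obtain p q r where c_eq: "c = [p, q, r]"
    using c(1) by (auto simp: length_Suc_conv numeral_3_eq_3)
  have cyc: "distinct c" "cycle_edges c \<subseteq> edges G" and fr: "frontier f = (\<Union>e\<in>cycle_edges c. curve G e)"
    using c by (auto simp: bounded_by_cycle_def is_cycle_def)
  have "p \<noteq> q" "q \<noteq> r" "r \<noteq> p" using cyc(1) c_eq by auto
  then obtain a b d where abd: "a < b" "b < d" "{{p, q}, {q, r}, {r, p}} = {{a, b}, {b, d}, {a, d}}"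
    by (rule sorted_triple)
  have ce: "cycle_edges c = {{a, b}, {b, d}, {a, d}}"
    using abd(3) by (simp only: c_eq cycle_edges_3)
  have T: "triangle a b d"
    using abd(1,2) cyc(2) unfolding triangle_def ce by blast
  have F: "frontier f = (\<Union>e\<in>{{a, b}, {b, d}, {a, d}}. curve G e)"
    using fr unfolding ce .
  have "f = inside (path_image (triangle_path a b d))"
    by (rule face_eq_inside[OF assms triangle_path(1,2)[OF T]]) (simp only: F triangle_path(3)[OF T])
  with T F show ?thesis by (rule that)
qed

lemma finite_faces: "finite (faces G)"
proof (rule finite_subset)
  let ?S = "insert (outer_face G) ((\<lambda>(a, b, d). inside (path_image (triangle_path a b d))) ` (verts G \<times> verts G \<times> verts G))"
  show "finite ?S" using finite_verts by simp
  show "faces G \<subseteq> ?S"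
  proof
    fix f assume f: "f \<in> faces G"
    show "f \<in> ?S"
    proof (cases "bounded f")
      case True
      obtain a b d where *: "triangle a b d" "f = inside (path_image (triangle_path a b d))"
        using bounded_face_triangle[OF f True] by metis
      then have "{a, b} \<subseteq> verts G" "{b, d} \<subseteq> verts G"
        using edge_subset unfolding triangle_def by blast+
      then have "(a, b, d) \<in> verts G \<times> verts G \<times> verts G" by simp
      then show ?thesis using *(2) by (intro insertI2 image_eqI[of _ _ "(a, b, d)"]) auto
    next
      case False
      then show ?thesis using face_bounded_or_outer[OF f] by simp
    qed
  qed
qed

lemma outer_cycle_path:
  obtains \<gamma> where "simple_path \<gamma>" "pathfinish \<gamma> = pathstart \<gamma>" "path_image \<gamma> = frontier (outer_face G)"
proof -
  obtain g t where g: "simple_path g" "pathfinish g = pathstart g" "t 0 = 0" "t (length C) = (1::real)"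
    "\<And>i. i < length C \<Longrightarrow> t i < t (i + 1)"
    "\<And>i. i < length C \<Longrightarrow> g ` {t i..t (i + 1)} = curve G {cyc_nth C i, cyc_nth C (i + 1)}"
    using cw unfolding clockwise_cycle_def by blast
  have mono: "k \<le> length C \<Longrightarrow> t 0 \<le> t k \<and> {t 0..t k} = (\<Union>i<k. {t i..t (i+1)}) \<union> {t 0}" for k
  proof (induction k)
    case (Suc k)
    have lt: "t k < t (Suc k)" using Suc.prems g(5)[of k] by simp
    have IH: "t 0 \<le> t k" "{t 0..t k} = (\<Union>i<k. {t i..t (i+1)}) \<union> {t 0}" using Suc by simp_all
    have X: "{t 0..t (Suc k)} = {t k..t (k+1)} \<union> {t 0..t k}" using lt IH(1) by auto
    show ?case
      by (intro conjI) (use lt IH(1) in simp, simp only: X IH(2) lessThan_Suc UN_insert Un_assoc)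
  qed auto
  have len: "length C \<ge> 3" using outer by (simp add: bounded_by_cycle_def is_cycle_def)
  have "t 0 \<in> {t 0..t (0+1)}" using g(5)[of 0] len by (simp add: less_imp_le flip: length_greater_0_conv)
  then have "t 0 \<in> (\<Union>i<length C. {t i..t (i+1)})" using len by (intro UN_I[of 0]) auto
  then have "{0..1} = (\<Union>i<length C. {t i..t (i+1)})"
    using mono[of "length C"] g(3,4) by auto
  then have "path_image g = (\<Union>i<length C. curve G {cyc_nth C i, cyc_nth C (i + 1)})"
    unfolding path_image_def image_UN using g(6) by (metis (no_types, lifting) SUP_cong image_UN lessThan_iff)
  also have "\<dots> = frontier (outer_face G)"
    using outer by (auto simp: bounded_by_cycle_def cycle_edges_def)
  finally show ?thesis using that g by blast
qed


lemma outer_cycle: "length C \<ge> 3" "distinct C" "set C \<subseteq> verts G" "cycle_edges C \<subseteq> edges G"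
    "frontier (outer_face G) = (\<Union>e\<in>cycle_edges C. curve G e)"
  using outer by (auto simp: bounded_by_cycle_def is_cycle_def)

lemma face_frontier:
  assumes "f \<in> faces G"
  obtains \<gamma> S where "simple_path \<gamma>" "pathfinish \<gamma> = pathstart \<gamma>" "path_image \<gamma> = frontier f"
    "S \<subseteq> edges G" "frontier f = (\<Union>e\<in>S. curve G e)"
proof (cases "bounded f")
  case True
  obtain a b d where T: "triangle a b d" "frontier f = (\<Union>e\<in>{{a, b}, {b, d}, {a, d}}. curve G e)"
    using bounded_face_triangle[OF assms True] by metis
  show ?thesis
    by (rule that[OF triangle_path(1,2)[OF T(1)] _ _ T(2)])
       (use T triangle_path(3)[OF T(1)] in \<open>auto simp: triangle_def\<close>)
next
  case False
  then have "f = outer_face G" using face_bounded_or_outer assms by blast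
  moreover obtain \<gamma> where "simple_path \<gamma>" "pathfinish \<gamma> = pathstart \<gamma>" "path_image \<gamma> = frontier (outer_face G)"
    by (rule outer_cycle_path)
  ultimately show ?thesis by (intro that[of \<gamma> "cycle_edges C"]) (use outer_cycle(4,5) in auto)
qed

lemma frontier_face_drawing: "f \<in> faces G \<Longrightarrow> frontier f \<subseteq> drawing G"
  by (erule face_frontier) (auto simp: drawing_def)

lemma edge_inner_point:
  assumes "e \<in> edges G"
  obtains x where "x \<in> curve G e" "x \<notin> place G ` verts G"
proof -
  obtain u v where uv: "u < v" "e = {u, v}" by (rule edgeE[OF assms])
  note p = epath[of u v] 
  have e: "{u, v} \<in> edges G" using assms uv by simp
  have arc: "inj_on (epath {u, v}) {0..1}" using p(1)[OF e uv(1)] by (simp add: arc_def)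
  define x where "x = epath {u, v} (1/2)"
  have "x \<noteq> place G u" "x \<noteq> place G v"
    using inj_onD[OF arc, of "1/2" 0] inj_onD[OF arc, of "1/2" 1] p(2,3)[OF e uv(1)]
    by (auto simp: x_def pathstart_def pathfinish_def)
  moreover have x: "x \<in> curve G e"
    using p(4)[OF e uv(1)] unfolding uv(2) x_def path_image_def by auto
  ultimately have "x \<notin> place G ` verts G"
    using curve_place[OF assms] uv by auto
  with x show ?thesis by (rule that)
qed

lemma edge_inner_point_frontier:
  assumes "f \<in> faces G" "e \<in> edges G" "x \<in> curve G e" "x \<notin> place G ` verts G"
  shows "x \<in> frontier f \<longleftrightarrow> curve G e \<subseteq> frontier f"
proof
  obtain S where S: "S \<subseteq> edges G" "frontier f = (\<Union>e\<in>S. curve G e)"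
    by (rule face_frontier[OF assms(1)])
  assume "x \<in> frontier f"
  then obtain e' where e': "e' \<in> S" "x \<in> curve G e'" using S by auto
  have "e' = e"
  proof (rule ccontr)
    assume "e' \<noteq> e"
    then have "x \<in> place G ` (e' \<inter> e)" using curve_inter[of e' e] S e' assms by blast
    then show False using assms(4) edge_subset[OF assms(2)] by auto
  qed
  then show "curve G e \<subseteq> frontier f" using e' S by auto
qed (use assms in auto)

lemma Union_faces: "\<Union>(faces G) = - drawing G"
  unfolding faces_def by (rule Union_components)

lemma face_meets:
  assumes "open S" "x \<in> closure S" "x \<in> drawing G"
  obtains f where "f \<in> faces G" "f \<inter> S \<noteq> {}" "x \<in> frontier f"
proof -
  define F where "F = {f \<in> faces G. f \<inter> S \<noteq> {}}"
  have "S - drawing G \<subseteq> \<Union>F"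
    using Union_faces by (auto simp: F_def)
  moreover have "closure S \<subseteq> closure (S - drawing G)"
  proof -
    have "closure (- drawing G) = UNIV" using interior_drawing by (simp add: closure_complement)
    then have "closure S = closure (S \<inter> closure (- drawing G))" by simp
    also have "\<dots> \<subseteq> closure (S \<inter> - drawing G)"
      using open_Int_closure_subset[OF assms(1), of "- drawing G"] closure_minimal by blast
    finally show ?thesis by (simp add: Diff_eq)
  qed
  ultimately have "x \<in> closure (\<Union>F)" using assms(2) closure_mono by blast
  also have "closure (\<Union>F) \<subseteq> \<Union>(closure ` F)"
  proof (rule closure_minimal)
    show "\<Union>F \<subseteq> \<Union>(closure ` F)" using closure_subset by blast
    show "closed (\<Union>(closure ` F))" using finite_faces by (intro closed_Union) (auto simp: F_def)
  qed
  finally obtain f where f: "f \<in> faces G" "f \<inter> S \<noteq> {}" "x \<in> closure f" by (auto simp: F_def)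
  then have "x \<in> frontier f"
    using faceD(2,4)[OF f(1)] assms(3) by (auto simp: frontier_def interior_open)
  with f show ?thesis using that by blast
qed

lemma face_subset:
  assumes "f \<in> faces G" "f \<inter> S \<noteq> {}" "frontier S \<subseteq> drawing G"
  shows "f \<subseteq> S"
  using connected_Int_frontier[OF faceD(1)[OF assms(1)] assms(2)] faceD(4)[OF assms(1)] assms(3) by auto

definition inner_faces :: "complex set set" where
  "inner_faces = {f \<in> faces G. bounded f}"

definition boundary_edges :: "complex set \<Rightarrow> 'a set set" where
  "boundary_edges f = {e \<in> edges G. curve G e \<subseteq> frontier f}"

lemma boundary_edges_eq:
  assumes "S \<subseteq> edges G" "frontier f = (\<Union>e\<in>S. curve G e)"
  shows "boundary_edges f = S"
proof
  show "S \<subseteq> boundary_edges f" using assms by (auto simp: boundary_edges_def)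
  show "boundary_edges f \<subseteq> S"
  proof
    fix e assume e: "e \<in> boundary_edges f"
    then have eG: "e \<in> edges G" by (simp add: boundary_edges_def)
    obtain x where x: "x \<in> curve G e" "x \<notin> place G ` verts G" by (rule edge_inner_point[OF eG])
    obtain e' where e': "e' \<in> S" "x \<in> curve G e'" using e x assms by (auto simp: boundary_edges_def)
    show "e \<in> S"
    proof (rule ccontr)
      assume "e \<notin> S"
      then have "e' \<noteq> e" using e' by auto
      then have "x \<in> place G ` (e' \<inter> e)" using curve_inter[of e' e] assms e' eG x by blast
      then show False using x(2) edge_subset[OF eG] by auto
    qed
  qed
qed

lemma finite_inner_faces: "finite inner_faces"
  using finite_faces by (simp add: inner_faces_def)

lemma inner_faceE:
  assumes "f \<in> inner_faces"
  obtains a b d where "triangle a b d" "boundary_edges f = {{a, b}, {b, d}, {a, d}}"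
    "f = inside (path_image (triangle_path a b d))"
proof -
  have f: "f \<in> faces G" "bounded f" using assms by (auto simp: inner_faces_def)
  obtain a b d where T: "triangle a b d" "frontier f = (\<Union>e\<in>{{a, b}, {b, d}, {a, d}}. curve G e)"
    "f = inside (path_image (triangle_path a b d))"
    by (rule bounded_face_triangle[OF f])
  have "boundary_edges f = {{a, b}, {b, d}, {a, d}}"
    by (rule boundary_edges_eq) (use T in \<open>auto simp: triangle_def\<close>)
  from that[OF T(1) this T(3)] show ?thesis .
qed

lemma edge_two_faces:
  assumes e: "e \<in> edges G"
  shows "2 \<le> card {f \<in> inner_faces. e \<in> boundary_edges f} + (if e \<in> cycle_edges C then 1 else 0)"
proof -
  obtain x where x: "x \<in> curve G e" "x \<notin> place G ` verts G" by (rule edge_inner_point[OF e])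
  have xd: "x \<in> drawing G" using x e by (auto simp: drawing_def)
  obtain f0 where f0: "f0 \<in> faces G" "x \<in> frontier f0"
    by (rule face_meets[of UNIV x]) (use xd in auto)
  obtain \<gamma> where \<gamma>: "simple_path \<gamma>" "pathfinish \<gamma> = pathstart \<gamma>" "path_image \<gamma> = frontier f0"
    by (rule face_frontier[OF f0(1)])
  note J = Jordan_inside_outside[OF \<gamma>(1,2)]
  have sub: "path_image \<gamma> \<subseteq> drawing G" using frontier_face_drawing[OF f0(1)] \<gamma>(3) by simp
  have xJ: "x \<in> path_image \<gamma>" using f0 \<gamma> by simp
  have cl: "x \<in> closure (inside (path_image \<gamma>))" "x \<in> closure (outside (path_image \<gamma>))"
    using J xJ unfolding frontier_def by blast+
  have op: "open (inside (path_image \<gamma>))" "open (outside (path_image \<gamma>))" using J by auto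
  obtain f1 where f1: "f1 \<in> faces G" "f1 \<inter> inside (path_image \<gamma>) \<noteq> {}" "x \<in> frontier f1"
    by (rule face_meets[OF op(1) cl(1) xd])
  obtain f2 where f2: "f2 \<in> faces G" "f2 \<inter> outside (path_image \<gamma>) \<noteq> {}" "x \<in> frontier f2"
    by (rule face_meets[OF op(2) cl(2) xd])
  have "f1 \<subseteq> inside (path_image \<gamma>)" by (rule face_subset[OF f1(1,2)]) (use J sub in simp)
  moreover have "f2 \<subseteq> outside (path_image \<gamma>)" by (rule face_subset[OF f2(1,2)]) (use J sub in simp)
  moreover have "inside (path_image \<gamma>) \<inter> outside (path_image \<gamma>) = {}" using J by simp
  ultimately have ne: "f1 \<noteq> f2" using f1(2) by blast
  let ?A = "{f \<in> inner_faces. e \<in> boundary_edges f}"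
  have inc: "f \<in> ?A \<or> f = outer_face G \<and> e \<in> cycle_edges C" if f: "f \<in> faces G" "x \<in> frontier f" for f
  proof -
    have ef: "e \<in> boundary_edges f"
      using edge_inner_point_frontier[OF f(1) e x] f(2) e by (simp add: boundary_edges_def)
    show ?thesis
    proof (cases "bounded f")
      case True
      then show ?thesis using f ef by (simp add: inner_faces_def)
    next
      case False
      then have "f = outer_face G" using face_bounded_or_outer f by blast
      then show ?thesis using ef boundary_edges_eq[OF outer_cycle(4,5)] by simp
    qed
  qed
  have fin: "finite ?A" using finite_inner_faces by simp
  show ?thesis
  proof (cases "f1 \<in> ?A \<and> f2 \<in> ?A")
    case True
    then have "card {f1, f2} \<le> card ?A" using fin by (intro card_mono) auto
    then show ?thesis using ne by simp
  next
    case False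
    then have "f1 \<in> ?A \<or> f2 \<in> ?A" "e \<in> cycle_edges C" using inc[OF f1(1,3)] inc[OF f2(1,3)] ne by auto
    then have "card ?A > 0" using fin by (auto simp: card_gt_0_iff)
    then show ?thesis using \<open>e \<in> cycle_edges C\<close> by simp
  qed
qed

lemma card_cycle_edges: "card (cycle_edges C) \<le> length C"
proof -
  have "cycle_edges C = (\<lambda>i. {cyc_nth C i, cyc_nth C (i + 1)}) ` {..<length C}"
    by (auto simp: cycle_edges_def)
  then show ?thesis using card_image_le[of "{..<length C}"] by simp
qed

lemma card_boundary_edges:
  assumes "f \<in> inner_faces"
  shows "card (boundary_edges f) = 3"
proof -
  obtain a b d where T: "triangle a b d" "boundary_edges f = {{a, b}, {b, d}, {a, d}}"
    by (rule inner_faceE[OF assms])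
  then have "a < b" "b < d" by (auto simp: triangle_def)
  then have "{a, b} \<noteq> {b, d}" "{a, b} \<noteq> {a, d}" "{b, d} \<noteq> {a, d}"
    by (auto simp: doubleton_eq_iff)
  then show ?thesis unfolding T(2) by simp
qed

lemma edges_faces_count: "2 * card (edges G) \<le> 3 * card inner_faces + length C"
proof -
  have "2 * card (edges G) = (\<Sum>e\<in>edges G. 2)" by simp
  also have "\<dots> \<le> (\<Sum>e\<in>edges G. card {f \<in> inner_faces. e \<in> boundary_edges f} + (if e \<in> cycle_edges C then 1 else 0))"
    by (intro sum_mono edge_two_faces)
  also have "\<dots> = (\<Sum>e\<in>edges G. card {f \<in> inner_faces. e \<in> boundary_edges f}) + (\<Sum>e\<in>edges G. if e \<in> cycle_edges C then 1 else 0)"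
    by (rule sum.distrib)
  also have "(\<Sum>e\<in>edges G. if e \<in> cycle_edges C then 1 else 0) = card (cycle_edges C)"
    using finite_edges outer_cycle(4) by (simp add: sum.If_cases Int_absorb1)
  also have "(\<Sum>e\<in>edges G. card {f \<in> inner_faces. e \<in> boundary_edges f}) = (\<Sum>f\<in>inner_faces. card (boundary_edges f))"
  proof -
    have "(\<Sum>e\<in>edges G. card {f \<in> inner_faces. e \<in> boundary_edges f}) = (\<Sum>e\<in>edges G. \<Sum>f\<in>inner_faces. if e \<in> boundary_edges f then 1 else 0)"
      using finite_inner_faces by (simp add: sum.If_cases Int_def)
    also have "\<dots> = (\<Sum>f\<in>inner_faces. \<Sum>e\<in>edges G. if e \<in> boundary_edges f then 1 else 0)"
      by (rule sum.swap)
    also have "\<dots> = (\<Sum>f\<in>inner_faces. card (boundary_edges f))"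
      using finite_edges by (intro sum.cong) (auto simp: sum.If_cases Int_def boundary_edges_def)
    finally show ?thesis .
  qed
  also have "\<dots> = 3 * card inner_faces" by (simp add: card_boundary_edges)
  finally show ?thesis using card_cycle_edges by linarith
qed

lemma connected_verts:
  assumes "A \<subseteq> verts G" "A \<noteq> {}" "\<And>u v. {u, v} \<in> edges G \<Longrightarrow> u \<in> A \<Longrightarrow> v \<in> A"
  shows "A = verts G"
proof (rule ccontr)
  assume "A \<noteq> verts G"
  define D where "D = (\<lambda>S. place G ` S \<union> (\<Union>e\<in>{e \<in> edges G. e \<subseteq> S}. curve G e))"
  define U where "U = (\<lambda>S. D S \<union> (\<Union>f\<in>{f \<in> faces G. frontier f \<subseteq> D S}. closure f))"
  define B where "B = verts G - A"
  have B: "B \<noteq> {}" "B \<subseteq> verts G" "A \<inter> B = {}" "A \<union> B = verts G"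
    using assms(1) \<open>A \<noteq> verts G\<close> by (auto simp: B_def)
  have split: "e \<subseteq> A \<or> e \<subseteq> B" if e: "e \<in> edges G" for e
  proof -
    obtain u v where uv: "u < v" "e = {u, v}" "u \<in> verts G" "v \<in> verts G" by (rule edgeE[OF e])
    have "{u, v} \<in> edges G" using uv e by auto
    moreover from this have "{v, u} \<in> edges G" by (simp add: insert_commute)
    ultimately have "u \<in> A \<longleftrightarrow> v \<in> A" using assms(3) by blast
    then show ?thesis using uv unfolding B_def by auto
  qed
  have clD: "closed (D S)" if "S \<subseteq> verts G" for S
  proof -
    have "finite S" using that finite_verts finite_subset by blast
    then show ?thesis unfolding D_def using finite_edges compact_curve
      by (intro closed_Un closed_UN) (auto simp: compact_imp_closed finite_imp_closed)
  qed
  have clU: "closed (U S)" if "S \<subseteq> verts G" for S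
    unfolding U_def using clD[OF that] finite_faces by (intro closed_Un closed_UN) auto
  have AB: "D A \<inter> D B = {}"
  proof -
    have c: "curve G e \<inter> place G ` T = {}" if "e \<in> edges G" "e \<subseteq> S" "S \<inter> T = {}" "S \<subseteq> verts G" "T \<subseteq> verts G" for e S T
    proof -
      have "curve G e \<inter> place G ` T \<subseteq> place G ` e" using curve_place[OF that(1)] that by blast
      moreover have "place G ` e \<inter> place G ` T = {}"
        using inj_on_image_Int[OF inj_place, of e T] that edge_subset[OF that(1)] by auto
      ultimately show ?thesis by blast
    qed
    have 1: "place G ` A \<inter> place G ` B = {}"
      using inj_on_image_Int[OF inj_place, of A B] B assms(1) by auto
    have 2: "curve G e \<inter> curve G e' = {}" if "e \<in> {e \<in> edges G. e \<subseteq> A}" "e' \<in> {e \<in> edges G. e \<subseteq> B}" for e e'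
    proof -
      have e: "e \<in> edges G" "e' \<in> edges G" "e \<inter> e' = {}" using that B(3) by blast+
      moreover have "e \<noteq> {}" using edge_card[OF e(1)] by auto
      ultimately show ?thesis using curve_inter[OF e(1,2)] by auto
    qed
    have 3: "curve G e \<inter> place G ` B = {}" if "e \<in> {e \<in> edges G. e \<subseteq> A}" for e
      by (rule c[OF _ _ B(3) assms(1) B(2)]) (use that in auto)
    have 4: "curve G e \<inter> place G ` A = {}" if "e \<in> {e \<in> edges G. e \<subseteq> B}" for e
      by (rule c[OF _ _ _ B(2) assms(1)]) (use B(3) that in auto)
    have 5: "(\<Union>e\<in>{e \<in> edges G. e \<subseteq> A}. curve G e) \<inter> place G ` B = {}" using 3 by blast
    have 6: "place G ` A \<inter> (\<Union>e\<in>{e \<in> edges G. e \<subseteq> B}. curve G e) = {}" using 4 by blast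
    have 7: "(\<Union>e\<in>{e \<in> edges G. e \<subseteq> A}. curve G e) \<inter> (\<Union>e\<in>{e \<in> edges G. e \<subseteq> B}. curve G e) = {}"
      using 2 by blast
    show ?thesis
      unfolding D_def Int_Un_distrib Int_Un_distrib2 1 5 6 7 by simp
  qed
  have cover: "D A \<union> D B = drawing G"
    unfolding D_def drawing_def using split B(4) by blast
  have fr: "frontier f \<subseteq> D A \<or> frontier f \<subseteq> D B" "frontier f \<noteq> {}" if f: "f \<in> faces G" for f
  proof -
    obtain \<gamma> where \<gamma>: "simple_path \<gamma>" "path_image \<gamma> = frontier f"
      by (rule face_frontier[OF f])
    have con: "connected (frontier f)"
      using \<gamma> connected_simple_path_image[of \<gamma>] by simp
    show "frontier f \<noteq> {}" using \<gamma> path_image_nonempty[of \<gamma>] by simp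
    have "frontier f \<subseteq> D A \<union> D B" using frontier_face_drawing[OF f] cover by simp
    then show "frontier f \<subseteq> D A \<or> frontier f \<subseteq> D B"
      using connected_closedD[OF con, of "D A" "D B"] AB clD[OF assms(1)] clD[OF B(2)] by blast
  qed
  have "U A \<union> U B = UNIV"
  proof -
    have "x \<in> U A \<union> U B" for x
    proof (cases "x \<in> drawing G")
      case True
      then show ?thesis using cover by (auto simp: U_def)
    next
      case False
      then obtain f where "f \<in> faces G" "x \<in> f"
        using Union_faces by blast
      then show ?thesis using fr(1)[of f] closure_subset[of f] unfolding U_def by blast
    qed
    then show ?thesis by auto
  qed
  moreover have "U A \<inter> U B = {}"
  proof -
    have cl: "closure f = f \<union> frontier f" for f :: "complex set"
      using closure_Un_frontier by auto
    have U: "U S = D S \<union> \<Union>{f \<in> faces G. frontier f \<subseteq> D S}" for S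
      unfolding U_def cl by blast
    have 1: "\<Union>{f \<in> faces G. frontier f \<subseteq> D S} \<inter> D T = {}" if "D T \<subseteq> drawing G" for S T
      using faceD(4) that by blast
    have 2: "\<Union>{f \<in> faces G. frontier f \<subseteq> D A} \<inter> \<Union>{f \<in> faces G. frontier f \<subseteq> D B} = {}"
    proof (rule ccontr)
      assume "\<not> ?thesis"
      then obtain f g where "f \<in> faces G" "frontier f \<subseteq> D A" "g \<in> faces G" "frontier g \<subseteq> D B" "f \<inter> g \<noteq> {}"
        by blast
      then show False using face_disjoint[of f g] fr(2)[of f] AB by blast
    qed
    have "D A \<subseteq> drawing G" "D B \<subseteq> drawing G" using cover by auto
    then show ?thesis unfolding U using 1[of B A] 1[of A B] 2 AB by blast
  qed
  moreover have "U A \<noteq> {}" "U B \<noteq> {}" using assms(2) B(1) by (auto simp: U_def D_def)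
  ultimately show False
    using connected_closedD[OF connected_UNIV, of "U A" "U B"] clU[OF assms(1)] clU[OF B(2)] by auto
qed

end

definition triangle_coeff :: "'a \<Rightarrow> 'a \<Rightarrow> 'a \<Rightarrow> 'a set \<Rightarrow> 'b::ring_1" where
  "triangle_coeff a b d e = (if e = {a, b} \<or> e = {b, d} then 1 else if e = {a, d} then -1 else 0)"

definition edge_end :: "'a::linorder \<Rightarrow> 'a set \<Rightarrow> real" where
  "edge_end v e = (if v = Max e then 1 else if v = Min e then -1 else 0)"

lemma of_real_triangle_coeff [simp]: "of_real (triangle_coeff a b d e) = triangle_coeff a b d e"
  by (simp add: triangle_coeff_def)

lemma sum_edge_end:
  assumes "finite V" "u < w" "u \<in> V" "w \<in> V"
  shows "(\<Sum>v\<in>V. b v * edge_end v {u, w}) = b w - b u"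
proof -
  have "(\<Sum>v\<in>V. b v * edge_end v {u, w}) = (\<Sum>v\<in>{u, w}. b v * edge_end v {u, w})"
    using assms by (intro sum.mono_neutral_right) (auto simp: edge_end_def)
  then show ?thesis using assms by (simp add: edge_end_def)
qed

context cycle_bounded_triangulation
begin

lemma sum_triangle_coeff:
  assumes "triangle a b d"
  shows "(\<Sum>e\<in>edges G. triangle_coeff a b d e * g e) = g {a, b} + g {b, d} - g {a, d}"
proof -
  have T: "a < b" "b < d" "{a, b} \<in> edges G" "{b, d} \<in> edges G" "{a, d} \<in> edges G"
    using assms by (auto simp: triangle_def)
  then have ne: "{a, b} \<noteq> {b, d}" "{a, b} \<noteq> {a, d}" "{b, d} \<noteq> {a, d}"
    by (auto simp: doubleton_eq_iff)
  have "(\<Sum>e\<in>edges G. triangle_coeff a b d e * g e) = (\<Sum>e\<in>{{a, b}, {b, d}, {a, d}}. triangle_coeff a b d e * g e)"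
    using T finite_edges by (intro sum.mono_neutral_right) (auto simp: triangle_coeff_def)
  also have "\<dots> = g {a, b} + (g {b, d} - g {a, d})"
    using ne ne[symmetric] by (simp add: triangle_coeff_def)
  finally show ?thesis by (simp add: algebra_simps)
qed

lemma winding_number_triangle_path:
  assumes "triangle a b d" "z \<notin> path_image (triangle_path a b d)"
  shows "winding_number (triangle_path a b d) z =
    (\<Sum>e\<in>edges G. triangle_coeff a b d e * winding_number (epath e) z)"
proof -
  have o: "a < b" "b < d" "a < d" and e: "{a, b} \<in> edges G" "{b, d} \<in> edges G" "{a, d} \<in> edges G"
    using assms by (auto simp: triangle_def)
  note p = epath[OF e(1) o(1)] epath[OF e(2) o(2)] epath[OF e(3) o(3)]
  have z: "z \<notin> curve G {a, b}" "z \<notin> curve G {b, d}" "z \<notin> curve G {a, d}"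
    using assms(2) triangle_path(3)[OF assms(1)] by auto
  have path: "path (epath {a, b})" "path (epath {b, d})" "path (epath {a, d})"
    using p by (auto intro: arc_imp_path)
  have "winding_number (triangle_path a b d) z =
      winding_number (epath {a, b} +++ epath {b, d}) z + winding_number (reversepath (epath {a, d})) z"
    unfolding triangle_path_def using p z path
    by (intro winding_number_join) (auto simp: path_image_join)
  also have "winding_number (epath {a, b} +++ epath {b, d}) z =
      winding_number (epath {a, b}) z + winding_number (epath {b, d}) z"
    using p z path by (intro winding_number_join) auto
  also have "winding_number (reversepath (epath {a, d})) z = - winding_number (epath {a, d}) z"
    using p z path by (intro winding_number_reversepath) auto
  finally show ?thesis using sum_triangle_coeff[OF assms(1), of "\<lambda>e. winding_number (epath e) z"] by simp
qed

text \<open>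
  The boundary cycles of the inner faces are linearly independent, since the winding number around
  a point of one of the faces is a linear functional that vanishes on all other boundary cycles.
  They are orthogonal to the coboundaries, which span a space of dimension \<open>n - 1\<close>.
\<close>

lemma inner_faces_verts_le_edges: "card inner_faces + card (verts G) \<le> card (edges G) + 1"
proof (rule ccontr)
  assume contr: "\<not> ?thesis"
  obtain v0 where v0: "v0 \<in> verts G" using outer_cycle(1,3) by (cases C) auto
  define V' where "V' = verts G - {v0}"
  have "\<forall>f\<in>inner_faces. \<exists>t. case t of (a, b, d) \<Rightarrow> triangle a b d \<and> f = inside (path_image (triangle_path a b d))"
  proof
    fix f assume "f \<in> inner_faces"
    then obtain a b d where "triangle a b d" "f = inside (path_image (triangle_path a b d))"
      by (rule inner_faceE)
    then show "\<exists>t. case t of (a, b, d) \<Rightarrow> triangle a b d \<and> f = inside (path_image (triangle_path a b d))"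
      by (intro exI[of _ "(a, b, d)"]) simp
  qed
  from bchoice[OF this] obtain t where "\<forall>f\<in>inner_faces.
      case t f of (a, b, d) \<Rightarrow> triangle a b d \<and> f = inside (path_image (triangle_path a b d))"
    by (rule exE)
  note t = bspec[OF this]
  define c :: "complex set \<Rightarrow> 'a set \<Rightarrow> real" where "c = (\<lambda>f e. case t f of (a, b, d) \<Rightarrow> triangle_coeff a b d e)"
  define A :: "complex set + 'a \<Rightarrow> 'a set \<Rightarrow> real" where "A = case_sum c edge_end"
  have "card (verts G) > 0" using v0 finite_verts by (auto simp: card_gt_0_iff)
  then have "card (edges G) < card (inner_faces <+> V')"
    using contr finite_inner_faces finite_verts v0 by (simp add: card_Plus V'_def)
  then obtain x where x: "\<exists>i\<in>inner_faces <+> V'. x i \<noteq> 0"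
    "\<forall>e\<in>edges G. (\<Sum>i\<in>inner_faces <+> V'. x i * A i e) = 0"
    using underdetermined_system[OF finite_edges, of "inner_faces <+> V'" A] finite_inner_faces finite_verts
    by (auto simp: V'_def)
  define \<alpha> where "\<alpha> = (\<lambda>e. \<Sum>f\<in>inner_faces. x (Inl f) * c f e)"
  define \<beta> where "\<beta> = (\<lambda>e. \<Sum>v\<in>V'. x (Inr v) * edge_end v e)"
  define b where "b = (\<lambda>v. if v = v0 then 0 else x (Inr v))"
  have \<alpha>\<beta>: "\<alpha> e + \<beta> e = 0" if "e \<in> edges G" for e
    using x(2) that finite_inner_faces finite_verts by (simp add: sum.Plus A_def \<alpha>_def \<beta>_def V'_def)
  have \<beta>: "\<beta> {u, w} = b w - b u" if "u < w" "{u, w} \<in> edges G" for u w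
  proof -
    have "\<beta> {u, w} = (\<Sum>v\<in>V'. b v * edge_end v {u, w})"
      unfolding \<beta>_def by (intro sum.cong) (auto simp: b_def V'_def)
    also have "\<dots> = (\<Sum>v\<in>verts G. b v * edge_end v {u, w})"
      using finite_verts by (intro sum.mono_neutral_left) (auto simp: V'_def b_def)
    also have "\<dots> = b w - b u"
      using that edge_subset[OF that(2)] finite_verts by (intro sum_edge_end) auto
    finally show ?thesis .
  qed
  have \<beta>_face: "(\<Sum>e\<in>edges G. c f e * \<beta> e) = 0" if f: "f \<in> inner_faces" for f
  proof -
    obtain a b' d where abd: "t f = (a, b', d)" by (rule prod_cases3)
    then have T: "triangle a b' d" using t[OF f] by simp
    then have "\<beta> {a, b'} = b b' - b a" "\<beta> {b', d} = b d - b b'" "\<beta> {a, d} = b d - b a"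
      using \<beta>[of a b'] \<beta>[of b' d] \<beta>[of a d] by (auto simp: triangle_def)
    then show ?thesis
      using sum_triangle_coeff[OF T, of \<beta>] by (simp add: c_def abd)
  qed
  have "(\<Sum>e\<in>edges G. \<beta> e * \<beta> e) = - (\<Sum>e\<in>edges G. \<alpha> e * \<beta> e)"
    unfolding sum_negf[symmetric] using \<alpha>\<beta> by (intro sum.cong) (auto simp: eq_neg_iff_add_eq_0 algebra_simps simp flip: distrib_right)
  also have "(\<Sum>e\<in>edges G. \<alpha> e * \<beta> e) = (\<Sum>e\<in>edges G. \<Sum>f\<in>inner_faces. x (Inl f) * (c f e * \<beta> e))"
    by (simp add: \<alpha>_def sum_distrib_right mult.assoc)
  also have "\<dots> = (\<Sum>f\<in>inner_faces. \<Sum>e\<in>edges G. x (Inl f) * (c f e * \<beta> e))"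
    by (rule sum.swap)
  also have "\<dots> = 0" by (simp add: sum_distrib_left[symmetric] \<beta>_face)
  finally have \<beta>0: "\<beta> e = 0" if "e \<in> edges G" for e
    using that finite_edges by (simp add: sum_nonneg_eq_0_iff)
  have "{v \<in> verts G. b v = 0} = verts G"
  proof (rule connected_verts)
    show "{v \<in> verts G. b v = 0} \<noteq> {}" using v0 by (auto simp: b_def)
    fix u v assume uv: "{u, v} \<in> edges G" "u \<in> {v \<in> verts G. b v = 0}"
    have "u \<noteq> v" using edge_card[OF uv(1)] by auto
    then have "b u = b v"
      using \<beta>[of u v] \<beta>[of v u] \<beta>0[OF uv(1)] uv(1) by (cases "u < v") (auto simp: insert_commute)
    then show "v \<in> {v \<in> verts G. b v = 0}" using uv edge_subset[OF uv(1)] by auto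
  qed auto
  then have xr: "x (Inr v) = 0" if "v \<in> V'" for v
    using that by (auto simp: b_def V'_def) (metis (mono_tags, lifting) mem_Collect_eq)
  have \<alpha>0: "\<alpha> e = 0" if "e \<in> edges G" for e using \<alpha>\<beta> \<beta>0 that by simp
  have xl: "x (Inl g) = 0" if g: "g \<in> inner_faces" for g
  proof -
    obtain z where z: "z \<in> g" using faceD(3) g by (auto simp: inner_faces_def)
    have zd: "z \<notin> drawing G" using faceD(4) g z by (auto simp: inner_faces_def)
    define w where "w = (\<lambda>f. \<Sum>e\<in>edges G. of_real (c f e) * winding_number (epath e) z)"
    have w: "w f = (if f = g then w g else 0) \<and> (f = g \<longrightarrow> w f \<noteq> 0)" if f: "f \<in> inner_faces" for f
    proof -
      obtain a b d where abd: "t f = (a, b, d)" by (rule prod_cases3)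
      then have T: "triangle a b d" and f_eq: "f = inside (path_image (triangle_path a b d))" using t[OF f] by simp_all
      have sub: "path_image (triangle_path a b d) \<subseteq> drawing G"
        using triangle_path(3)[OF T] T by (auto simp: drawing_def triangle_def)
      then have zp: "z \<notin> path_image (triangle_path a b d)" using zd by auto
      have wf: "w f = winding_number (triangle_path a b d) z"
        using winding_number_triangle_path[OF T zp] by (simp add: w_def c_def abd)
      show ?thesis
      proof (cases "f = g")
        case True
        then have "z \<in> inside (path_image (triangle_path a b d))" using z f_eq by simp
        then have "w f \<noteq> 0"
          unfolding wf by (rule_tac simple_closed_path_winding_number_inside[OF triangle_path(1)[OF T]]) auto
        then show ?thesis using True by simp
      next
        case False
        then have "z \<notin> f" using face_disjoint[of f g] f g z by (auto simp: inner_faces_def)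
        then have "z \<in> outside (path_image (triangle_path a b d))"
          using f_eq zp inside_Un_outside[of "path_image (triangle_path a b d)"] by blast
        then have "w f = 0"
          unfolding wf using triangle_path(1,2)[OF T] 
          by (intro winding_number_zero_in_outside) (auto intro: simple_path_imp_path)
        then show ?thesis using False by simp
      qed
    qed
    have "0 = (\<Sum>e\<in>edges G. of_real (\<alpha> e) * winding_number (epath e) z)" by (simp add: \<alpha>0)
    also have "\<dots> = (\<Sum>e\<in>edges G. \<Sum>f\<in>inner_faces. of_real (x (Inl f)) * (of_real (c f e) * winding_number (epath e) z))"
      by (simp add: \<alpha>_def sum_distrib_right mult.assoc)
    also have "\<dots> = (\<Sum>f\<in>inner_faces. \<Sum>e\<in>edges G. of_real (x (Inl f)) * (of_real (c f e) * winding_number (epath e) z))"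
      by (rule sum.swap)
    also have "\<dots> = (\<Sum>f\<in>inner_faces. of_real (x (Inl f)) * w f)"
      by (simp add: w_def sum_distrib_left)
    also have "\<dots> = (\<Sum>f\<in>inner_faces. if f = g then of_real (x (Inl g)) * w g else 0)"
      by (intro sum.cong refl) (use w in auto)
    also have "\<dots> = of_real (x (Inl g)) * w g" using finite_inner_faces g by simp
    finally show ?thesis using w[OF g] by simp
  qed
  show False using x(1) xl xr by auto
qed

lemma card_edges_lower: "3 * card (verts G) \<le> card (edges G) + length C + 3"
  using inner_faces_verts_le_edges edges_faces_count by linarith

end

subsection \<open>The number of edges of a straight-line plane graph\<close>

lemma finite_maximizer:
  fixes f :: "'a \<Rightarrow> 'b::linorder"
  assumes "finite K" "K \<noteq> {}"
  obtains u where "u \<in> K" "\<And>p. p \<in> K \<Longrightarrow> f p \<le> f u"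
proof -
  have "Max (f ` K) \<in> f ` K" using assms by simp
  then obtain u where u: "u \<in> K" "Max (f ` K) = f u" by auto
  have "f p \<le> f u" if "p \<in> K" for p
    using that assms u(2)[symmetric] by simp
  with u(1) show ?thesis by (rule that)
qed

definition slope :: "complex \<Rightarrow> complex \<Rightarrow> real" where
  "slope a b = (Im b - Im a) / (Re b - Re a)"

definition height :: "complex \<Rightarrow> complex \<Rightarrow> real \<Rightarrow> real" where
  "height a b x = Im b - slope a b * (Re b - x)"

lemma height_right [simp]: "height a b (Re b) = Im b"
  by (simp add: height_def)

lemma height_left: "Re a < Re b \<Longrightarrow> height a b (Re a) = Im a"
  by (simp add: height_def slope_def)

lemma segment_iff_height:
  assumes "Re a < Re b"
  shows "z \<in> convex hull {a, b} \<longleftrightarrow> Re a \<le> Re z \<and> Re z \<le> Re b \<and> Im z = height a b (Re z)"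
proof
  assume "z \<in> convex hull {a, b}"
  then obtain u where u: "0 \<le> u" "u \<le> 1" "z = (1 - u) *\<^sub>R a + u *\<^sub>R b"
    unfolding segment_convex_hull[symmetric] in_segment by blast
  have R: "Re z = Re a + u * (Re b - Re a)" and I: "Im z = Im a + u * (Im b - Im a)"
    using arg_cong[OF u(3), of Re] arg_cong[OF u(3), of Im] by (simp_all add: algebra_simps)
  have "0 \<le> u * (Re b - Re a)" "u * (Re b - Re a) \<le> 1 * (Re b - Re a)"
    using u assms by (auto intro!: mult_right_mono)
  moreover have "Im z = height a b (Re z)"
    using assms unfolding R I height_def slope_def by (simp add: field_simps)
  ultimately show "Re a \<le> Re z \<and> Re z \<le> Re b \<and> Im z = height a b (Re z)" using R by auto
next
  assume z: "Re a \<le> Re z \<and> Re z \<le> Re b \<and> Im z = height a b (Re z)"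
  define u where "u = (Re z - Re a) / (Re b - Re a)"
  have "0 \<le> u" "u \<le> 1" using z assms by (auto simp: u_def)
  moreover have "z = (1 - u) *\<^sub>R a + u *\<^sub>R b"
  proof (rule complex_eqI)
    have "u * (Re b - Re a) = Re z - Re a" using assms by (simp add: u_def)
    then show "Re z = Re ((1 - u) *\<^sub>R a + u *\<^sub>R b)" by (simp add: algebra_simps)
    have "Im z = Im b - (Im b - Im a) / (Re b - Re a) * (Re b - Re z)"
      using z by (simp add: height_def slope_def)
    also have "\<dots> = Im a + u * (Im b - Im a)"
      using assms by (simp add: u_def field_simps)
    finally show "Im z = Im ((1 - u) *\<^sub>R a + u *\<^sub>R b)" by (simp add: algebra_simps)
  qed
  ultimately show "z \<in> convex hull {a, b}"
    unfolding segment_convex_hull[symmetric] in_segment by blast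
qed

lemma height_crossing:
  assumes "x1 < x2" "height a b x1 < height c d x1" "height c d x2 < height a b x2"
  obtains x where "x1 < x" "x < x2" "height a b x = height c d x"
proof -
  define f where "f = (\<lambda>x. height a b x - height c d x)"
  have "continuous_on {x1..x2} f" unfolding f_def height_def by (intro continuous_intros)
  then obtain x where x: "x1 \<le> x" "x \<le> x2" "f x = 0"
    using IVT'[of f x1 0 x2] assms by (auto simp: f_def)
  moreover have "x \<noteq> x1" "x \<noteq> x2" using x(3) assms by (auto simp: f_def)
  ultimately show ?thesis using that[of x] by (auto simp: f_def)
qed

lemma height_less_iff:
  "x < Re v \<Longrightarrow> height a v x < height b v x \<longleftrightarrow> slope b v < slope a v"
  by (simp add: height_def)

locale straight_line_edges =
  fixes P :: "complex set" and E :: "complex set set"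
  assumes finite_points: "finite P"
    and edge_subset: "e \<in> E \<Longrightarrow> e \<subseteq> P"
    and edge_card: "e \<in> E \<Longrightarrow> card e = 2"
    and edge_points: "e \<in> E \<Longrightarrow> p \<in> P \<Longrightarrow> p \<in> convex hull e \<Longrightarrow> p \<in> e"
    and edge_inter: "e \<in> E \<Longrightarrow> e' \<in> E \<Longrightarrow> e \<noteq> e' \<Longrightarrow> convex hull e \<inter> convex hull e' \<subseteq> e \<inter> e'"
begin

definition above :: "complex \<Rightarrow> (complex set \<times> complex) set" where
  "above u = {(e, z). e \<in> E \<and> z \<in> convex hull e \<and> Re z = Re u \<and> Im u < Im z}"

definition below :: "complex \<Rightarrow> (complex set \<times> complex) set" where
  "below u = {(e, z). e \<in> E \<and> z \<in> convex hull e \<and> Re z = Re u \<and> Im z < Im u}"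

definition right_end :: "complex set \<Rightarrow> complex" where
  "right_end e = (THE v. v \<in> e \<and> (\<forall>w\<in>e. Re w \<le> Re v))"

lemma right_end: "Re a < Re b \<Longrightarrow> right_end {a, b} = b"
  unfolding right_end_def by (rule the_equality) auto

lemma finite_edges: "finite E"
  by (rule finite_subset[of _ "Pow P"]) (use edge_subset finite_points in auto)

end

locale generic_straight_line_edges = straight_line_edges +
  assumes inj_Re: "inj_on Re P"
begin

lemma edgeE:
  assumes "e \<in> E"
  obtains a b where "e = {a, b}" "Re a < Re b" "a \<in> P" "b \<in> P"
proof -
  obtain x y where xy: "e = {x, y}" "x \<noteq> y" using edge_card[OF assms] by (meson card_2_iff)
  have V: "x \<in> P" "y \<in> P" using edge_subset[OF assms] xy by auto
  have "Re x \<noteq> Re y" using inj_onD[OF inj_Re _ V] xy by auto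
  then consider "Re x < Re y" | "Re y < Re x" by linarith
  then show ?thesis
  proof cases
    case 1
    show ?thesis by (rule that[OF xy(1) 1 V])
  next
    case 2
    show ?thesis by (rule that[OF _ 2 V(2,1)]) (use xy in auto)
  qed
qed

lemma same_height:
  assumes "{a, b} \<in> E" "{c, d} \<in> E" "{a, b} \<noteq> {c, d}" "Re a < Re b" "Re c < Re d"
    and "Re a \<le> x" "x \<le> Re b" "Re c \<le> x" "x \<le> Re d" "height a b x = height c d x"
  shows "Complex x (height a b x) \<in> {a, b} \<inter> {c, d}"
proof -
  have "Complex x (height a b x) \<in> convex hull {a, b} \<inter> convex hull {c, d}"
    using assms by (simp add: segment_iff_height)
  then show ?thesis using edge_inter[OF assms(1-3)] by blast
qed

lemma no_crossing:
  assumes "{a, b} \<in> E" "{c, d} \<in> E" "Re a < Re b" "Re c < Re d" "x1 < x2"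
    and "Re a \<le> x1" "x2 \<le> Re b" "Re c \<le> x1" "x2 \<le> Re d" "height a b x1 < height c d x1"
  shows "height a b x2 \<le> height c d x2"
proof (rule ccontr)
  assume "\<not> ?thesis"
  then obtain x where x: "x1 < x" "x < x2" "height a b x = height c d x"
    using height_crossing[of x1 x2 a b c d] assms by auto
  have "{a, b} \<noteq> {c, d}"
    using assms by (auto simp: doubleton_eq_iff)
  then have "Complex x (height a b x) \<in> {a, b}"
    using same_height[OF assms(1,2) _ assms(3,4), of x] x assms by auto
  then show False using x assms by auto
qed

text \<open>
  \<open>a\<close> is the next left neighbour of \<open>v\<close> above the edge \<open>bv\<close>. The rightmost point \<open>u\<close> of the wedge
  between the two edges sees both of them along its vertical line.
\<close>

lemma wedge_point:
  assumes bv: "{b, v} \<in> E" "Re b < Re v" and av: "{a, v} \<in> E" "Re a < Re v"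
    and sl: "slope a v < slope b v"
    and mx: "\<And>a'. {a', v} \<in> E \<Longrightarrow> Re a' < Re v \<Longrightarrow> slope a' v < slope b v \<Longrightarrow> slope a' v \<le> slope a v"
  obtains u where "u \<in> P" "Re b \<le> Re u" "Re a \<le> Re u" "Re u < Re v"
    "height b v (Re u) \<le> Im u" "Im u \<le> height a v (Re u)"
    "\<And>w w'. {w, w'} \<in> E \<Longrightarrow> Re w < Re w' \<Longrightarrow> Re w \<le> Re u \<Longrightarrow> Re u \<le> Re w' \<Longrightarrow>
       height b v (Re u) < height w w' (Re u) \<Longrightarrow> height w w' (Re u) < height a v (Re u) \<Longrightarrow>
       height w w' (Re u) = Im u"
proof -
  define K where "K = {p \<in> P. Re b \<le> Re p \<and> Re a \<le> Re p \<and> Re p < Re v \<and>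
    height b v (Re p) \<le> Im p \<and> Im p \<le> height a v (Re p)}"
  have V: "a \<in> P" "b \<in> P" "v \<in> P" using edge_subset[OF bv(1)] edge_subset[OF av(1)] by auto
  have ba: "height b v x < height a v x" if "x < Re v" for x using height_less_iff[OF that] sl by simp
  have "K \<noteq> {}"
  proof (cases "Re a \<le> Re b")
    case True
    then have "b \<in> K" using V bv av ba[of "Re b"] by (auto simp: K_def height_left)
    then show ?thesis by auto
  next
    case False
    then have "a \<in> K" using V bv av ba[of "Re a"] by (auto simp: K_def height_left)
    then show ?thesis by auto
  qed
  moreover have "finite K" using finite_points by (simp add: K_def)
  ultimately obtain u where u: "u \<in> K" "\<And>p. p \<in> K \<Longrightarrow> Re p \<le> Re u"
    using finite_maximizer[of K Re] by blast
  have uK: "u \<in> P" "Re b \<le> Re u" "Re a \<le> Re u" "Re u < Re v"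
    "height b v (Re u) \<le> Im u" "Im u \<le> height a v (Re u)" using u(1) by (auto simp: K_def)
  show ?thesis
  proof (rule that[OF uK])
    fix w w' assume w: "{w, w'} \<in> E" "Re w < Re w'" "Re w \<le> Re u" "Re u \<le> Re w'"
      "height b v (Re u) < height w w' (Re u)" "height w w' (Re u) < height a v (Re u)"
    have wP: "w \<in> P" "w' \<in> P" using edge_subset[OF w(1)] by auto
    show "height w w' (Re u) = Im u"
    proof (rule ccontr)
      assume ne: "height w w' (Re u) \<noteq> Im u"
      have "Re u \<noteq> Re w'"
        using ne inj_onD[OF inj_Re _ uK(1) wP(2)] by auto
      then have uw': "Re u < Re w'" using w(4) by simp
      have squeeze: "height b v x \<le> height w w' x \<and> height w w' x \<le> height a v x"
        if "Re u < x" "x \<le> Re w'" "x \<le> Re v" for x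
        using no_crossing[OF bv(1) w(1) bv(2) w(2) that(1)] no_crossing[OF w(1) av(1) w(2) av(2) that(1)]
          that w uK by auto
      consider "Re w' < Re v" | "Re w' = Re v" | "Re v < Re w'" by linarith
      then show False
      proof cases
        case 1
        then have "w' \<in> K" using squeeze[OF uw'] wP uw' uK by (auto simp: K_def)
        then show False using u(2)[of w'] uw' by simp
      next
        case 2
        then have "w' = v" using inj_onD[OF inj_Re _ wP(2) V(3)] by simp
        then have "slope w v < slope b v" "slope a v < slope w v"
          using w(5,6) uK(4) by (simp_all add: height_less_iff)
        then show False using mx[of w] w \<open>w' = v\<close> by simp
      next
        case 3
        have "height w w' (Re v) = Im v" using squeeze[of "Re v"] uK 3 by simp
        then have "v \<in> convex hull {w, w'}" using 3 w uK by (simp add: segment_iff_height)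
        then have "v \<in> {w, w'}" using edge_points[OF w(1) V(3)] by simp
        then show False using 3 w uK by auto
      qed
    qed
  qed
qed

lemma adjacent_below_unique:
  assumes "(e, z) \<in> below u" "\<And>e' z'. (e', z') \<in> below u \<Longrightarrow> Im z' \<le> Im z" "u \<in> P"
    and "(f, y) \<in> below u" "\<And>e' z'. (e', z') \<in> below u \<Longrightarrow> Im z' \<le> Im y"
  shows "e = f"
proof (rule ccontr)
  assume ne: "e \<noteq> f"
  have "z = y" using assms(1,2,4,5) by (auto simp: below_def complex_eq_iff intro!: antisym)
  then have "z \<in> e \<inter> f" using assms(1,4) edge_inter[of e f] ne by (auto simp: below_def)
  then have "z \<in> P" using assms(1) edge_subset by (auto simp: below_def)
  then have "z = u" using inj_onD[OF inj_Re, of z u] assms by (auto simp: below_def)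
  then show False using assms(1) by (simp add: below_def)
qed

lemma adjacent_above_unique:
  assumes "(e, z) \<in> above u" "\<And>e' z'. (e', z') \<in> above u \<Longrightarrow> Im z \<le> Im z'" "u \<in> P"
    and "(f, y) \<in> above u" "\<And>e' z'. (e', z') \<in> above u \<Longrightarrow> Im y \<le> Im z'"
  shows "e = f"
proof (rule ccontr)
  assume ne: "e \<noteq> f"
  have "z = y" using assms(1,2,4,5) by (auto simp: above_def complex_eq_iff intro!: antisym)
  then have "z \<in> e \<inter> f" using assms(1,4) edge_inter[of e f] ne by (auto simp: above_def)
  then have "z \<in> P" using assms(1) edge_subset by (auto simp: above_def)
  then have "z = u" using inj_onD[OF inj_Re, of z u] assms by (auto simp: above_def)
  then show False using assms(1) by (simp add: above_def)
qed

definition top_edges :: "complex set set" where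
  "top_edges = {e. \<exists>b v. e = {b, v} \<and> e \<in> E \<and> Re b < Re v \<and>
     (\<forall>a. {a, v} \<in> E \<longrightarrow> Re a < Re v \<longrightarrow> slope b v \<le> slope a v)}"

lemma card_top_edges:
  assumes "P \<noteq> {}"
  shows "card top_edges + 1 \<le> card P"
proof -
  obtain l where l: "l \<in> P" "\<And>p. p \<in> P \<Longrightarrow> Re l \<le> Re p"
    by (rule finite_maximizer[OF finite_points assms, of "\<lambda>p. - Re p"]) auto
  have "inj_on right_end top_edges"
  proof (rule inj_onI)
    fix e e' assume "e \<in> top_edges" "e' \<in> top_edges" and eq: "right_end e = right_end e'"
    then obtain b v b' v' where e: "e = {b, v}" "{b, v} \<in> E" "Re b < Re v"
        "\<And>a. {a, v} \<in> E \<Longrightarrow> Re a < Re v \<Longrightarrow> slope b v \<le> slope a v"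
      and e': "e' = {b', v'}" "{b', v'} \<in> E" "Re b' < Re v'"
        "\<And>a. {a, v'} \<in> E \<Longrightarrow> Re a < Re v' \<Longrightarrow> slope b' v' \<le> slope a v'"
      unfolding top_edges_def by blast
    have v: "v' = v" using eq e(1,3) e'(1,3) by (simp add: right_end)
    have s: "slope b v = slope b' v"
      using e(2,3,4) e'(2,3,4) v by (auto intro!: antisym)
    have same: "c = d" if "{c, v} \<in> E" "Re c < Re v" "{d, v} \<in> E" "Re d < Re v" "slope c v = slope d v" "Re c \<le> Re d" for c d
    proof -
      have "height c v (Re d) = Im d" using that height_left[of d v] by (simp add: height_def)
      then have "d \<in> convex hull {c, v}" using that by (simp add: segment_iff_height)
      moreover have "d \<in> P" using edge_subset[OF that(3)] by simp
      ultimately have "d \<in> {c, v}" using edge_points[OF that(1)] by blast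
      then show "c = d" using that by auto
    qed
    have b': "{b', v} \<in> E" "Re b' < Re v" using e'(2,3) v by auto
    have "b = b'"
    proof (cases "Re b \<le> Re b'")
      case True
      show ?thesis by (rule same[OF e(2,3) b' s True])
    next
      case False
      then have "Re b' \<le> Re b" by simp
      from same[OF b' e(2,3) s[symmetric] this] show ?thesis by simp
    qed
    then show "e = e'" using e(1) e'(1) v by simp
  qed
  then have "card top_edges = card (right_end ` top_edges)" by (simp add: card_image)
  also have "\<dots> \<le> card (P - {l})"
  proof (rule card_mono)
    show "right_end ` top_edges \<subseteq> P - {l}"
    proof
      fix x assume "x \<in> right_end ` top_edges"
      then obtain b v where e: "x = right_end {b, v}" "{b, v} \<in> E" "Re b < Re v"
        unfolding top_edges_def by auto
      then have "x = v" "b \<in> P" "v \<in> P" using edge_subset[OF e(2)] by (auto simp: right_end)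
      then show "x \<in> P - {l}" using l(2)[of b] e(3) by auto
    qed
  qed (use finite_points in auto)
  finally show ?thesis using l(1) finite_points card_gt_0_iff[of P] by (auto simp: card_Diff_singleton)
qed

lemma edge_cases:
  assumes "e \<in> E" "e \<notin> top_edges"
  shows "(\<exists>u z. u \<in> P \<and> (e, z) \<in> below u \<and> (\<forall>e' z'. (e', z') \<in> below u \<longrightarrow> Im z' \<le> Im z)) \<or>
    (\<exists>u f z. u \<in> P \<and> e = {u, right_end f} \<and> (f, z) \<in> above u \<and> (\<forall>e' z'. (e', z') \<in> above u \<longrightarrow> Im z \<le> Im z'))"
proof -
  obtain b v where bv: "e = {b, v}" "Re b < Re v" by (rule edgeE[OF assms(1)])
  define A where "A = {a. {a, v} \<in> E \<and> Re a < Re v \<and> slope a v < slope b v}"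
  have "A \<subseteq> P" using edge_subset by (auto simp: A_def)
  then have "finite A" using finite_points finite_subset by blast
  moreover have "A \<noteq> {}" using assms bv by (auto simp: top_edges_def A_def not_le)
  ultimately obtain a where a: "a \<in> A" "\<And>a'. a' \<in> A \<Longrightarrow> slope a' v \<le> slope a v"
    using finite_maximizer[of A "\<lambda>a. slope a v"] by blast
  have av: "{a, v} \<in> E" "Re a < Re v" "slope a v < slope b v" using a(1) by (auto simp: A_def)
  have bvE: "{b, v} \<in> E" using assms(1) bv(1) by simp
  obtain u where u: "u \<in> P" "Re b \<le> Re u" "Re a \<le> Re u" "Re u < Re v"
    "height b v (Re u) \<le> Im u" "Im u \<le> height a v (Re u)" and
    between: "\<And>w w'. {w, w'} \<in> E \<Longrightarrow> Re w < Re w' \<Longrightarrow> Re w \<le> Re u \<Longrightarrow> Re u \<le> Re w' \<Longrightarrow>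
       height b v (Re u) < height w w' (Re u) \<Longrightarrow> height w w' (Re u) < height a v (Re u) \<Longrightarrow>
       height w w' (Re u) = Im u"
    by (rule wedge_point[OF bvE bv(2) av]) (use a(2) in \<open>auto simp: A_def\<close>)
  have ba: "height b v (Re u) < height a v (Re u)" using height_less_iff[OF u(4)] av(3) by simp
  have bt: "Im z' = Im u" if *: "e' \<in> E" "z' \<in> convex hull e'" "Re z' = Re u"
      "height b v (Re u) < Im z'" "Im z' < height a v (Re u)" for e' z'
  proof -
    obtain w w' where w: "e' = {w, w'}" "Re w < Re w'" by (rule edgeE[OF *(1)])
    show ?thesis using between[of w w'] * w by (simp add: segment_iff_height)
  qed
  show ?thesis
  proof (cases "u = b")
    case False
    define z where "z = Complex (Re u) (height b v (Re u))"
    have zh: "z \<in> convex hull {b, v}" using u bv(2) by (simp add: z_def segment_iff_height)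
    have "Im u \<noteq> height b v (Re u)"
    proof
      assume "Im u = height b v (Re u)"
      then have "z = u" by (simp add: z_def complex_eq_iff)
      then have "u \<in> {b, v}" using zh edge_points[OF bvE u(1)] by simp
      then show False using False u by auto
    qed
    then have "(e, z) \<in> below u" using u zh assms(1) bv(1) by (simp add: below_def z_def)
    moreover have "Im z' \<le> Im z" if "(e', z') \<in> below u" for e' z'
      using bt[of e' z'] that u by (force simp: below_def z_def)
    ultimately show ?thesis using u(1) by blast
  next
    case True
    define z where "z = Complex (Re u) (height a v (Re u))"
    have zh: "z \<in> convex hull {a, v}" using u av(2) by (simp add: z_def segment_iff_height)
    have hb: "height b v (Re u) = Im u" using True height_left bv(2) by simp
    have "({a, v}, z) \<in> above u" using u zh av ba hb by (simp add: above_def z_def)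
    moreover have "Im z \<le> Im z'" if "(e', z') \<in> above u" for e' z'
      using bt[of e' z'] that hb by (force simp: above_def z_def)
    moreover have "e = {u, right_end {a, v}}" using right_end[OF av(2)] True bv(1) by simp
    ultimately show ?thesis using u(1) by blast
  qed
qed

lemma card_edges_le:
  assumes "P \<noteq> {}"
  shows "card E + 1 \<le> card P + card {u \<in> P. above u \<noteq> {}} + card {u \<in> P. below u \<noteq> {}}"
proof -
  define g where "g = (\<lambda>u. SOME e. \<exists>z. (e, z) \<in> below u \<and> (\<forall>e' z'. (e', z') \<in> below u \<longrightarrow> Im z' \<le> Im z))"
  define h where "h = (\<lambda>u. SOME e. \<exists>z. (e, z) \<in> above u \<and> (\<forall>e' z'. (e', z') \<in> above u \<longrightarrow> Im z \<le> Im z'))"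
  let ?U = "{u \<in> P. above u \<noteq> {}}" and ?D = "{u \<in> P. below u \<noteq> {}}"
  have g: "g u = e" if "u \<in> P" "(e, z) \<in> below u" "\<forall>e' z'. (e', z') \<in> below u \<longrightarrow> Im z' \<le> Im z" for u e z
    unfolding g_def
  proof (rule some_equality)
    fix f assume "\<exists>z. (f, z) \<in> below u \<and> (\<forall>e' z'. (e', z') \<in> below u \<longrightarrow> Im z' \<le> Im z)"
    then obtain y where y: "(f, y) \<in> below u" "\<And>e' z'. (e', z') \<in> below u \<Longrightarrow> Im z' \<le> Im y" by blast
    show "f = e" by (rule adjacent_below_unique[OF y that(1,2) that(3)[rule_format]])
  qed (use that in blast)
  have h: "h u = e" if "u \<in> P" "(e, z) \<in> above u" "\<forall>e' z'. (e', z') \<in> above u \<longrightarrow> Im z \<le> Im z'" for u e z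
    unfolding h_def
  proof (rule some_equality)
    fix f assume "\<exists>z. (f, z) \<in> above u \<and> (\<forall>e' z'. (e', z') \<in> above u \<longrightarrow> Im z \<le> Im z')"
    then obtain y where y: "(f, y) \<in> above u" "\<And>e' z'. (e', z') \<in> above u \<Longrightarrow> Im y \<le> Im z'" by blast
    show "f = e" by (rule adjacent_above_unique[OF y that(1,2) that(3)[rule_format]])
  qed (use that in blast)
  have "E \<subseteq> top_edges \<union> ((\<lambda>u. {u, right_end (h u)}) ` ?U \<union> g ` ?D)"
  proof
    fix e assume e: "e \<in> E"
    show "e \<in> top_edges \<union> ((\<lambda>u. {u, right_end (h u)}) ` ?U \<union> g ` ?D)"
    proof (cases "e \<in> top_edges")
      case False
      from edge_cases[OF e False] show ?thesis
      proof (elim disjE exE conjE)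
        fix u z assume *: "u \<in> P" "(e, z) \<in> below u" "\<forall>e' z'. (e', z') \<in> below u \<longrightarrow> Im z' \<le> Im z"
        then have "u \<in> ?D" by auto
        then show ?thesis using g[OF *] by (intro UnI2 image_eqI[of _ _ u]) auto
      next
        fix u f z assume *: "u \<in> P" "(f, z) \<in> above u" "\<forall>e' z'. (e', z') \<in> above u \<longrightarrow> Im z \<le> Im z'" and
          e: "e = {u, right_end f}"
        then have "u \<in> ?U" by auto
        then show ?thesis using h[OF *] e by (intro UnI2 UnI1 image_eqI[of _ _ u]) auto
      qed
    qed auto
  qed
  moreover have fin: "finite ?U" "finite ?D" "finite top_edges"
    using finite_points finite_subset[OF _ finite_edges, of top_edges] by (auto simp: top_edges_def)
  ultimately have "card E \<le> card (top_edges \<union> ((\<lambda>u. {u, right_end (h u)}) ` ?U \<union> g ` ?D))"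
    by (intro card_mono) auto
  also have "\<dots> \<le> card top_edges + (card ?U + card ?D)"
    by (intro order_trans[OF card_Un_le] add_mono order_refl card_image_le fin)
  finally show ?thesis using card_top_edges[OF assms] by linarith
qed

end

lemma Con_mult: "Con (d * a) (d * b) (d * c) = (cmod d)\<^sup>2 * Con a b c"
  unfolding cmod_power2 by (simp add: Con_def power2_eq_square algebra_simps)

lemma Con_affine:
  assumes "s + t = 1"
  shows "Con u (s *\<^sub>R a + t *\<^sub>R b) v = s * Con u a v + t * Con u b v"
proof -
  have t: "t = 1 - s" using assms by simp
  show ?thesis unfolding t by (simp add: Con_def algebra_simps)
qed

lemma Con_convex_hull:
  assumes "\<And>w. w \<in> P \<Longrightarrow> Con u w v \<le> 0" "z \<in> convex hull P"
  shows "Con u z v \<le> 0"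
proof -
  have "convex {w. Con u w v \<le> 0}"
    unfolding convex_def
    by (auto simp: Con_affine intro!: add_nonpos_nonpos mult_nonneg_nonpos)
  then have "convex hull P \<subseteq> {w. Con u w v \<le> 0}"
    using assms(1) by (intro hull_minimal) auto
  then show ?thesis using assms(2) by auto
qed

definition supporting_polygon :: "complex set \<Rightarrow> complex set \<Rightarrow> bool" where
  "supporting_polygon P H \<longleftrightarrow> H \<subseteq> P \<and> (\<forall>u\<in>H.
     (\<exists>v\<in>H. v \<noteq> u \<and> (\<forall>w\<in>P. Con u w v \<le> 0)) \<and>
     (\<exists>v\<in>H. v \<noteq> u \<and> (\<forall>w\<in>P. Con v w u \<le> 0)))"

lemma supporting_polygon_mult:
  assumes "supporting_polygon P H" "d \<noteq> 0"
  shows "supporting_polygon ((*) d ` P) ((*) d ` H)"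
  using assms unfolding supporting_polygon_def
  by (auto simp: Con_mult mult_le_0_iff image_mono)

context generic_straight_line_edges
begin

lemma card_edges_polygon:
  assumes H: "supporting_polygon P H" "H \<noteq> {}"
  shows "card E + card H + 3 \<le> 3 * card P"
proof -
  define A where "A = {u \<in> P. above u = {}}"
  define B where "B = {u \<in> P. below u = {}}"
  have HP: "H \<subseteq> P" using H by (simp add: supporting_polygon_def)
  have nxt: "\<exists>v\<in>H. v \<noteq> u \<and> Re v \<noteq> Re u \<and> (Re v > Re u \<longrightarrow> u \<in> A) \<and> (Re v < Re u \<longrightarrow> u \<in> B)" if "u \<in> H" for u
  proof -
    have "\<exists>v\<in>H. v \<noteq> u \<and> (\<forall>w\<in>P. Con u w v \<le> 0)"
      using H(1) that by (simp add: supporting_polygon_def)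
    then obtain v where v: "v \<in> H" "v \<noteq> u" "\<And>w. w \<in> P \<Longrightarrow> Con u w v \<le> 0" by blast
    have ne: "Re v \<noteq> Re u" using inj_onD[OF inj_Re, of v u] v HP that by auto
    have eq: "Con u z v = (Re v - Re u) * (Im z - Im u)" if "Re z = Re u" for z
      using that by (simp add: Con_def algebra_simps)
    have le: "Con u z v \<le> 0" if "e \<in> E" "z \<in> convex hull e" for e z
    proof (rule Con_convex_hull)
      show "z \<in> convex hull P" using that hull_mono[OF edge_subset[OF that(1)], of convex] by auto
    qed (use v in auto)
    have "u \<in> A" if "Re v > Re u"
    proof -
      have "Im z \<le> Im u" if "e \<in> E" "z \<in> convex hull e" "Re z = Re u" for e z
        using le[OF that(1,2)] eq[OF that(3)] \<open>Re v > Re u\<close> by (simp add: mult_le_0_iff)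
      then show ?thesis using \<open>u \<in> H\<close> HP by (force simp: A_def above_def)
    qed
    moreover have "u \<in> B" if "Re v < Re u"
    proof -
      have "Im z \<ge> Im u" if "e \<in> E" "z \<in> convex hull e" "Re z = Re u" for e z
        using le[OF that(1,2)] eq[OF that(3)] \<open>Re v < Re u\<close> by (simp add: mult_le_0_iff)
      then show ?thesis using \<open>u \<in> H\<close> HP by (force simp: B_def below_def)
    qed
    ultimately show ?thesis using v ne by auto
  qed
  have prv: "\<exists>v\<in>H. v \<noteq> u \<and> Re v \<noteq> Re u \<and> (Re v > Re u \<longrightarrow> u \<in> B) \<and> (Re v < Re u \<longrightarrow> u \<in> A)" if "u \<in> H" for u
  proof -
    have "\<exists>v\<in>H. v \<noteq> u \<and> (\<forall>w\<in>P. Con v w u \<le> 0)"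
      using H(1) that by (simp add: supporting_polygon_def)
    then obtain v where v: "v \<in> H" "v \<noteq> u" "\<And>w. w \<in> P \<Longrightarrow> Con v w u \<le> 0" by blast
    have ne: "Re v \<noteq> Re u" using inj_onD[OF inj_Re, of v u] v HP that by auto
    have eq: "Con v z u = (Re u - Re v) * (Im z - Im u)" if "Re z = Re u" for z
      using that by (simp add: Con_def algebra_simps)
    have le: "Con v z u \<le> 0" if "e \<in> E" "z \<in> convex hull e" for e z
    proof (rule Con_convex_hull)
      show "z \<in> convex hull P" using that hull_mono[OF edge_subset[OF that(1)], of convex] by auto
    qed (use v in auto)
    have "u \<in> A" if "Re v < Re u"
    proof -
      have "Im z \<le> Im u" if "e \<in> E" "z \<in> convex hull e" "Re z = Re u" for e z
        using le[OF that(1,2)] eq[OF that(3)] \<open>Re v < Re u\<close> by (simp add: mult_le_0_iff)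
      then show ?thesis using \<open>u \<in> H\<close> HP by (force simp: A_def above_def)
    qed
    moreover have "u \<in> B" if "Re v > Re u"
    proof -
      have "Im z \<ge> Im u" if "e \<in> E" "z \<in> convex hull e" "Re z = Re u" for e z
        using le[OF that(1,2)] eq[OF that(3)] \<open>Re v > Re u\<close> by (simp add: mult_le_0_iff)
      then show ?thesis using \<open>u \<in> H\<close> HP by (force simp: B_def below_def)
    qed
    ultimately show ?thesis using v ne by auto
  qed
  have finH: "finite H" using HP finite_points finite_subset by blast
  obtain l where l: "l \<in> H" "\<And>p. p \<in> H \<Longrightarrow> Re l \<le> Re p"
    by (rule finite_maximizer[OF finH H(2), of "\<lambda>p. - Re p"]) auto
  obtain r where r: "r \<in> H" "\<And>p. p \<in> H \<Longrightarrow> Re p \<le> Re r"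
    using finite_maximizer[OF finH H(2), of Re] by blast
  have lAB: "l \<in> A \<inter> B" using nxt[OF l(1)] prv[OF l(1)] l(2) by force
  have rAB: "r \<in> A \<inter> B" using nxt[OF r(1)] prv[OF r(1)] r(2) by force
  have lr: "l \<noteq> r"
  proof
    assume "l = r"
    then have "Re p = Re l" if "p \<in> H" for p using l r that by force
    then show False using nxt[OF l(1)] by auto
  qed
  have fin: "finite A" "finite B" using finite_points by (auto simp: A_def B_def)
  have "H \<subseteq> A \<union> B" using nxt by force
  then have "card H \<le> card (A \<union> B)" using fin by (intro card_mono) auto
  moreover have "card {l, r} \<le> card (A \<inter> B)" using fin lAB rAB by (intro card_mono) auto
  moreover have "card A + card B = card (A \<union> B) + card (A \<inter> B)" using fin by (rule card_Un_Int)
  ultimately have AB: "card H + 2 \<le> card A + card B" using lr by simp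
  have "{u \<in> P. above u \<noteq> {}} = P - A" "{u \<in> P. below u \<noteq> {}} = P - B" by (auto simp: A_def B_def)
  then have "card {u \<in> P. above u \<noteq> {}} = card P - card A" "card {u \<in> P. below u \<noteq> {}} = card P - card B"
    using fin by (simp_all add: card_Diff_subset A_def B_def)
  moreover have "card A \<le> card P" "card B \<le> card P"
    using finite_points by (auto intro!: card_mono simp: A_def B_def)
  moreover have "P \<noteq> {}" using H HP by auto
  ultimately show ?thesis using card_edges_le AB by linarith
qed

end

lemma generic_direction:
  fixes P :: "complex set"
  assumes "finite P"
  obtains d where "d \<noteq> 0" "inj_on Re ((*) d ` P)"
proof -
  define T where "T = (\<lambda>(p, q). Re (p - q) / Im (p - q)) ` (P \<times> P)"
  have "finite T" using assms by (simp add: T_def)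
  then obtain t where t: "t \<notin> T" using ex_new_if_finite infinite_UNIV_char_0 by blast
  have "inj_on Re ((*) (Complex 1 t) ` P)"
  proof (rule inj_onI)
    fix x y assume "x \<in> (*) (Complex 1 t) ` P" "y \<in> (*) (Complex 1 t) ` P" and eq: "Re x = Re y"
    then obtain p q where pq: "p \<in> P" "q \<in> P" "x = Complex 1 t * p" "y = Complex 1 t * q" by auto
    then have *: "Re (p - q) = t * Im (p - q)" using eq by (simp add: algebra_simps)
    have "Im (p - q) = 0"
    proof (rule ccontr)
      assume "Im (p - q) \<noteq> 0"
      then have "t = Re (p - q) / Im (p - q)" using * by (simp add: field_simps)
      then have "t \<in> T" unfolding T_def using pq by (intro image_eqI[of _ _ "(p, q)"]) auto
      then show False using t by simp
    qed
    then have "p = q" using * by (simp add: complex_eq_iff)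
    then show "x = y" using pq by simp
  qed
  moreover have "Complex 1 t \<noteq> 0" by (simp add: complex_eq_iff)
  ultimately show ?thesis using that by blast
qed

lemma (in straight_line_edges) straight_line_edges_mult:
  assumes "d \<noteq> 0"
  shows "straight_line_edges ((*) d ` P) ((`) ((*) d) ` E)"
proof -
  have inj: "inj ((*) d)" using assms by (simp add: inj_on_def)
  have hull: "convex hull ((*) d ` e) = (*) d ` (convex hull e)" for e
    by (rule convex_hull_linear_image[symmetric]) (intro linearI, auto simp: algebra_simps)
  show ?thesis
  proof
    fix e p assume e: "e \<in> (`) ((*) d) ` E"
    then obtain f where f: "f \<in> E" "e = (*) d ` f" by auto
    show "e \<subseteq> (*) d ` P" using f edge_subset by auto
    show "card e = 2" using f edge_card card_image[OF inj_on_subset[OF inj subset_UNIV], of f] by simp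
    assume "p \<in> (*) d ` P" "p \<in> convex hull e"
    then have "p \<in> (*) d ` P" "p \<in> (*) d ` (convex hull f)" using f(2) hull by simp_all
    then obtain q q' where q: "q \<in> P" "p = d * q" "q' \<in> convex hull f" "p = d * q'" by blast
    then have "q' = q" using assms by simp
    then have "q \<in> f" using edge_points[OF f(1)] q by simp
    then show "p \<in> e" unfolding f(2) q(2) by (rule imageI)
  next
    fix e e' assume "e \<in> (`) ((*) d) ` E" "e' \<in> (`) ((*) d) ` E" "e \<noteq> e'"
    then obtain f f' where f: "f \<in> E" "e = (*) d ` f" "f' \<in> E" "e' = (*) d ` f'" "f \<noteq> f'" by auto
    show "convex hull e \<inter> convex hull e' \<subseteq> e \<inter> e'"
      unfolding f(2,4) hull image_Int[OF inj, symmetric]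
      by (intro image_mono edge_inter f)
  qed (use finite_points in auto)
qed

lemma (in straight_line_edges) card_edges_upper:
  assumes H: "supporting_polygon P H" "H \<noteq> {}"
  shows "card E + card H + 3 \<le> 3 * card P"
proof -
  obtain d where d: "d \<noteq> 0" "inj_on Re ((*) d ` P)" by (rule generic_direction[OF finite_points])
  have inj: "inj ((*) d)" using d by (simp add: inj_on_def)
  interpret M: straight_line_edges "(*) d ` P" "(`) ((*) d) ` E" by (rule straight_line_edges_mult[OF d(1)])
  interpret M: generic_straight_line_edges "(*) d ` P" "(`) ((*) d) ` E" by standard (rule d(2))
  have "inj_on ((`) ((*) d)) E" using inj by (simp add: inj_on_def inj_image_eq_iff)
  then show ?thesis
    using M.card_edges_polygon[OF supporting_polygon_mult[OF H(1) d(1)]] H(2) inj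
    by (simp add: card_image inj_on_subset[OF inj])
qed

subsection \<open>Empty circles\<close>

definition empty_circle :: "complex set \<Rightarrow> complex set \<Rightarrow> complex \<Rightarrow> real \<Rightarrow> bool" where
  "empty_circle P S c r \<longleftrightarrow> r \<ge> 0 \<and> (\<forall>p\<in>S. cmod (p - c) = r) \<and> (\<forall>p\<in>P. r \<le> cmod (p - c))"

definition strictly_empty_circle :: "complex set \<Rightarrow> complex set \<Rightarrow> complex \<Rightarrow> real \<Rightarrow> bool" where
  "strictly_empty_circle P S c r \<longleftrightarrow> empty_circle P S c r \<and> (\<forall>p\<in>P - S. r < cmod (p - c))"

lemma cmod_diff_affine:
  assumes "s + t = (1::real)"
  shows "(cmod (s *\<^sub>R a + t *\<^sub>R b - c))\<^sup>2 = s * (cmod (a - c))\<^sup>2 + t * (cmod (b - c))\<^sup>2 - s * t * (cmod (a - b))\<^sup>2"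
proof -
  have t: "t = 1 - s" using assms by simp
  show ?thesis unfolding cmod_power2 t by (simp add: algebra_simps power2_eq_square)
qed

lemma hull_interior_of_circle:
  fixes c :: complex
  assumes S: "\<And>s. s \<in> S \<Longrightarrow> cmod (s - c) = r" and p: "p \<in> convex hull S" "p \<notin> S"
  shows "cmod (p - c) < r"
proof (rule ccontr)
  assume "\<not> ?thesis"
  moreover have "r \<ge> 0" using S p(1) by (metis convex_hull_empty empty_iff ex_in_conv norm_ge_zero)
  moreover have "convex hull S \<subseteq> cball c r"
    using S by (intro hull_minimal) (auto simp: dist_norm norm_minus_commute)
  ultimately have pr: "cmod (p - c) = r"
    using p(1) by (auto simp: dist_norm norm_minus_commute subset_iff not_less intro: antisym)
  have "(s - c) \<bullet> (p - c) < r\<^sup>2" if "s \<in> S" for s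
  proof -
    have "0 < (cmod (s - p))\<^sup>2" using that p(2) by auto
    also have "(cmod (s - p))\<^sup>2 = (cmod (s - c))\<^sup>2 + (cmod (p - c))\<^sup>2 - 2 * ((s - c) \<bullet> (p - c))"
      unfolding cmod_power2 by (simp add: inner_complex_def power2_eq_square algebra_simps)
    finally show ?thesis using S[OF that] pr by simp
  qed
  then have "S \<subseteq> {s. (p - c) \<bullet> s < r\<^sup>2 + (p - c) \<bullet> c}"
    by (auto simp: inner_diff_left inner_commute diff_less_eq)
  then have "convex hull S \<subseteq> {s. (p - c) \<bullet> s < r\<^sup>2 + (p - c) \<bullet> c}"
    by (intro hull_minimal convex_halfspace_lt)
  then have "(p - c) \<bullet> p - (p - c) \<bullet> c < r\<^sup>2" using p(1) by auto
  then show False using pr by (simp add: inner_diff_right[symmetric] dot_square_norm)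
qed

lemma empty_circle_points:
  assumes "empty_circle P S c r" "p \<in> P" "p \<in> convex hull S"
  shows "p \<in> S"
proof (rule ccontr)
  assume "p \<notin> S"
  then have "cmod (p - c) < r"
    using assms by (intro hull_interior_of_circle[of S]) (auto simp: empty_circle_def)
  then show False using assms by (auto simp: empty_circle_def not_less[symmetric])
qed

text \<open>
  The difference of the powers with respect to the two circles is an affine function that is
  nonpositive on the first edge and nonnegative on the second one.
\<close>

lemma delaunay_edges_noncrossing:
  assumes e: "e \<subseteq> P" "card e = 2" "strictly_empty_circle P e c r"
    and e': "e' \<subseteq> P" "card e' = 2" "empty_circle P e' c' r'"
    and ne: "e \<noteq> e'"
  shows "convex hull e \<inter> convex hull e' \<subseteq> e \<inter> e'"
proof
  fix z assume z: "z \<in> convex hull e \<inter> convex hull e'"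
  define D where "D = (\<lambda>p. ((cmod (p - c))\<^sup>2 - r\<^sup>2) - ((cmod (p - c'))\<^sup>2 - r'\<^sup>2))"
  have r: "r \<ge> 0" "r' \<ge> 0" using e(3) e'(3) by (auto simp: empty_circle_def strictly_empty_circle_def)
  have aff: "D (s *\<^sub>R a + t *\<^sub>R b) = s * D a + t * D b" if "s + t = 1" for s t a b
  proof -
    have t: "t = 1 - s" using that by simp
    show ?thesis unfolding D_def cmod_diff_affine[OF that] unfolding t by (simp add: algebra_simps)
  qed
  have De: "D p \<le> 0" if "p \<in> e" for p
  proof -
    have "cmod (p - c) = r" "r' \<le> cmod (p - c')"
      using that e e'(3) by (auto simp: empty_circle_def strictly_empty_circle_def)
    then show ?thesis using r by (auto simp: D_def intro!: power_mono)
  qed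
  have De': "D p \<ge> 0" and De'0: "D p = 0 \<Longrightarrow> p \<in> e" if "p \<in> e'" for p
  proof -
    have p: "cmod (p - c') = r'" "r \<le> cmod (p - c)" "p \<notin> e \<Longrightarrow> r < cmod (p - c)"
      using that e e' by (auto simp: empty_circle_def strictly_empty_circle_def)
    then show "D p \<ge> 0" using r by (auto simp: D_def intro!: power_mono)
    show "p \<in> e" if "D p = 0"
    proof (rule ccontr)
      assume "p \<notin> e"
      then have "r\<^sup>2 < (cmod (p - c))\<^sup>2" using p(3) r by (intro power_strict_mono) auto
      then show False using that p(1) by (simp add: D_def)
    qed
  qed
  obtain a b where ab: "e = {a, b}" using e(2) by (meson card_2_iff)
  obtain a' b' where ab': "e' = {a', b'}" "a' \<noteq> b'" using e'(2) by (meson card_2_iff)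
  have zs: "z \<in> closed_segment a b" "z \<in> closed_segment a' b'"
    using z ab ab' by (simp_all add: segment_convex_hull)
  obtain u where u: "0 \<le> u" "u \<le> 1" "z = (1 - u) *\<^sub>R a + u *\<^sub>R b"
    using zs(1) unfolding in_segment by (elim exE conjE)
  obtain v where v: "0 \<le> v" "v \<le> 1" "z = (1 - v) *\<^sub>R a' + v *\<^sub>R b'"
    using zs(2) unfolding in_segment by (elim exE conjE)
  have "(1 - u) * D a \<le> 0" "u * D b \<le> 0"
    using De[of a] De[of b] ab u(1,2) by (auto simp: mult_le_0_iff)
  then have "D z \<le> 0" unfolding u(3) using aff[of "1 - u" u a b] by simp
  moreover have "D z = (1 - v) * D a' + v * D b'" unfolding v(3) by (rule aff) simp
  moreover have "(1 - v) * D a' \<ge> 0" "v * D b' \<ge> 0" using De'[of a'] De'[of b'] ab' v(1,2) by auto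
  ultimately have 0: "(1 - v) * D a' = 0" "v * D b' = 0" by linarith+
  show "z \<in> e \<inter> e'"
  proof (cases "v = 0 \<or> v = 1")
    case True
    then show ?thesis
    proof
      assume "v = 0"
      then show ?thesis using v(3) 0 De'0[of a'] ab' by simp
    next
      assume "v = 1"
      then show ?thesis using v(3) 0 De'0[of b'] ab' by simp
    qed
  next
    case False
    then have "a' \<in> e" "b' \<in> e" using 0 De'0[of a'] De'0[of b'] ab' by auto
    then have "e' \<subseteq> e" "finite e" using ab' ab by auto
    then have "e' = e" using card_subset_eq[of e e'] e(2) e'(2) by auto
    then show ?thesis using ne by simp
  qed
qed

lemma circumcircle_exists:
  fixes a b d :: complex
  assumes "\<not> collinear {a, b, d}"
  obtains c where "cmod (b - c) = cmod (a - c)" "cmod (d - c) = cmod (a - c)"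
proof -
  define u v where "u = b - a" and "v = d - a"
  have nc: "\<not> collinear {0, u, v}"
    using assms collinear_3[of b a d] by (simp add: u_def v_def insert_commute)
  define D where "D = Re u * Im v - Im u * Re v"
  have D: "D \<noteq> 0"
  proof
    assume D0: "D = 0"
    have u: "u \<noteq> 0" using nc by auto
    define k where "k = (u \<bullet> v) / (cmod u)\<^sup>2"
    have n: "(cmod u)\<^sup>2 \<noteq> 0" using u by simp
    have D0': "Re u * Im v = Im u * Re v" using D0 by (simp add: D_def)
    have "(cmod u)\<^sup>2 * Re v = (u \<bullet> v) * Re u"
      unfolding cmod_power2 inner_complex_def using D0' by algebra
    moreover have "(cmod u)\<^sup>2 * Im v = (u \<bullet> v) * Im u"
      unfolding cmod_power2 inner_complex_def using D0' by algebra
    ultimately have "Re v = k * Re u" "Im v = k * Im u" using n by (simp_all add: k_def field_simps)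
    then have "v = k *\<^sub>R u" by (simp add: complex_eq_iff)
    then show False using nc unfolding collinear_lemma by blast
  qed
  define w where "w = Complex (((cmod u)\<^sup>2 * Im v - (cmod v)\<^sup>2 * Im u) / (2 * D)) (((cmod v)\<^sup>2 * Re u - (cmod u)\<^sup>2 * Re v) / (2 * D))"
  have w: "2 * D * Re w = (cmod u)\<^sup>2 * Im v - (cmod v)\<^sup>2 * Im u" "2 * D * Im w = (cmod v)\<^sup>2 * Re u - (cmod u)\<^sup>2 * Re v"
    using D by (simp_all add: w_def)
  have "D * (2 * (u \<bullet> w)) = D * (cmod u)\<^sup>2"
    using w unfolding inner_complex_def D_def by algebra
  moreover have "D * (2 * (v \<bullet> w)) = D * (cmod v)\<^sup>2"
    using w unfolding inner_complex_def D_def by algebra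
  ultimately have uw: "2 * (u \<bullet> w) = (cmod u)\<^sup>2" "2 * (v \<bullet> w) = (cmod v)\<^sup>2" using D by simp_all
  have *: "(cmod (x - w))\<^sup>2 = (cmod x)\<^sup>2 - 2 * (x \<bullet> w) + (cmod w)\<^sup>2" for x
    unfolding cmod_power2 by (simp add: inner_complex_def power2_eq_square algebra_simps)
  have "(cmod (u - w))\<^sup>2 = (cmod w)\<^sup>2" "(cmod (v - w))\<^sup>2 = (cmod w)\<^sup>2" unfolding * using uw by simp_all
  then have "cmod (u - w) = cmod w" "cmod (v - w) = cmod w" by simp_all
  then show ?thesis
    by (intro that[of "a + w"]) (simp_all add: u_def v_def algebra_simps norm_minus_commute)
qed

lemma collinear_hull_segment:
  fixes a b d x :: "'a::euclidean_space"
  assumes "collinear {a, b, d}" "x \<in> convex hull {a, b, d}"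
  shows "\<exists>p\<in>{a, b, d}. \<exists>q\<in>{a, b, d}. x \<in> convex hull {p, q}"
proof -
  have *: "convex hull {y, p, q} = convex hull {p, q}" if "between (p, q) y" for y p q :: 'a
    using that by (intro hull_redundant) (simp add: between_mem_segment segment_convex_hull)
  have "{a, b, d} = {b, d, a}" "{a, b, d} = {d, a, b}" by auto
  then have h: "convex hull {a, b, d} = convex hull {b, d, a}" "convex hull {a, b, d} = convex hull {d, a, b}" by simp_all
  consider "between (b, d) a" | "between (d, a) b" | "between (a, b) d"
    using assms(1) collinear_between_cases by blast
  then show ?thesis
  proof cases
    case 1 then show ?thesis using *[of b d a] assms(2) by auto
  next
    case 2 then show ?thesis using *[of d a b] assms(2) h(1) by auto
  next
    case 3 then show ?thesis using *[of a b d] assms(2) h(2) by auto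
  qed
qed

lemma card_le_2_subset:
  assumes "finite S" "card S \<le> 2" "S \<noteq> {}"
  shows "\<exists>p\<in>S. \<exists>q\<in>S. S = {p, q}"
proof -
  have "card S = 1 \<or> card S = 2" using assms by (auto simp: card_eq_0_iff le_Suc_eq numeral_2_eq_2)
  then show ?thesis by (auto simp: card_1_singleton_iff card_2_iff)
qed

lemma exchange_triangle:
  fixes x :: "'a::real_vector"
  assumes S: "finite S" and lam: "\<And>p. p \<in> S \<Longrightarrow> \<kappa> p > (0::real)" "sum \<kappa> S = 1" "(\<Sum>p\<in>S. \<kappa> p *\<^sub>R p) = x"
    and mu: "sum \<mu> S = 1" "(\<Sum>p\<in>S. \<mu> p *\<^sub>R p) = d" and d: "d \<notin> S"
  obtains i \<nu> where "i \<in> S" "\<And>p. p \<in> insert d (S - {i}) \<Longrightarrow> \<nu> p \<ge> 0" "\<nu> d > 0"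
    "sum \<nu> (insert d (S - {i})) = 1" "(\<Sum>p\<in>insert d (S - {i}). \<nu> p *\<^sub>R p) = x"
proof -
  define T where "T = {p \<in> S. \<mu> p > 0}"
  have "T \<noteq> {}"
  proof
    assume "T = {}"
    then have "sum \<mu> S \<le> 0" by (intro sum_nonpos) (auto simp: T_def not_less)
    then show False using mu by simp
  qed
  moreover have finT: "finite T" using S by (simp add: T_def)
  ultimately have "Min ((\<lambda>p. \<kappa> p / \<mu> p) ` T) \<in> (\<lambda>p. \<kappa> p / \<mu> p) ` T" by (intro Min_in) auto
  then obtain i where i: "i \<in> T" "Min ((\<lambda>p. \<kappa> p / \<mu> p) ` T) = \<kappa> i / \<mu> i" by auto
  have imin: "\<kappa> i / \<mu> i \<le> \<kappa> p / \<mu> p" if "p \<in> T" for p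
    unfolding i(2)[symmetric] using finT that by (intro Min_le) auto
  define t where "t = \<kappa> i / \<mu> i"
  have iS: "i \<in> S" "\<mu> i > 0" using i by (auto simp: T_def)
  have t: "t > 0" using lam(1)[OF iS(1)] iS(2) by (simp add: t_def)
  define \<nu> where "\<nu> = (\<lambda>p. if p = d then t else \<kappa> p - t * \<mu> p)"
  have i0: "\<kappa> i - t * \<mu> i = 0" using iS by (simp add: t_def)
  have \<nu>S: "\<nu> p = \<kappa> p - t * \<mu> p" if "p \<in> S" for p using that d by (auto simp: \<nu>_def)
  have nn: "\<nu> p \<ge> 0" if "p \<in> S" for p
  proof (cases "\<mu> p > 0")
    case True
    then have "t \<le> \<kappa> p / \<mu> p" using imin[of p] that by (simp add: T_def t_def)
    then show ?thesis using True \<nu>S[OF that] by (simp add: field_simps)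
  next
    case False
    then have "t * \<mu> p \<le> 0" using t by (simp add: mult_le_0_iff)
    then show ?thesis using \<nu>S[OF that] lam(1)[OF that] by simp
  qed
  have "sum \<nu> (insert d (S - {i})) = t + sum \<nu> (S - {i})"
    using S d by (simp add: \<nu>_def)
  also have "sum \<nu> (S - {i}) = (\<Sum>p\<in>S. \<kappa> p - t * \<mu> p)"
    using S iS i0 \<nu>S by (simp add: sum.remove[OF S iS(1)])
  also have "\<dots> = 1 - t" using lam mu by (simp add: sum_subtractf sum_distrib_left[symmetric])
  finally have s1: "sum \<nu> (insert d (S - {i})) = 1" by simp
  have "(\<Sum>p\<in>insert d (S - {i}). \<nu> p *\<^sub>R p) = t *\<^sub>R d + (\<Sum>p\<in>S - {i}. \<nu> p *\<^sub>R p)"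
    using S d by (simp add: \<nu>_def)
  also have "(\<Sum>p\<in>S - {i}. \<nu> p *\<^sub>R p) = (\<Sum>p\<in>S. (\<kappa> p - t * \<mu> p) *\<^sub>R p)"
    using S iS i0 \<nu>S by (simp add: sum.remove[OF S iS(1)])
  also have "\<dots> = x - t *\<^sub>R d"
    using lam(3) unfolding mu(2)[symmetric] by (simp add: scaleR_diff_left sum_subtractf scaleR_sum_right)
  finally have s2: "(\<Sum>p\<in>insert d (S - {i}). \<nu> p *\<^sub>R p) = x" by simp
  show ?thesis
  proof (rule that[OF iS(1) _ _ s1 s2])
    show d0: "\<nu> d > 0" using t by (simp add: \<nu>_def)
    show "\<nu> p \<ge> 0" if "p \<in> insert d (S - {i})" for p
      using that nn[of p] d0 by (cases "p = d") auto
  qed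
qed

lemma sum_power_of_point:
  fixes x c :: complex
  assumes "sum \<kappa> S = 1" "(\<Sum>p\<in>S. \<kappa> p *\<^sub>R p) = x"
  shows "(\<Sum>p\<in>S. \<kappa> p * (cmod (p - c))\<^sup>2) = (\<Sum>p\<in>S. \<kappa> p * (cmod (p - x))\<^sup>2) + (cmod (x - c))\<^sup>2"
proof -
  have *: "(cmod (p - c))\<^sup>2 = (cmod (p - x))\<^sup>2 + (cmod (x - c))\<^sup>2 + 2 * ((x - c) \<bullet> p) - 2 * ((x - c) \<bullet> x)" for p
    unfolding cmod_power2 by (simp add: inner_complex_def power2_eq_square algebra_simps)
  have i: "(\<Sum>p\<in>S. \<kappa> p * ((x - c) \<bullet> p)) = (x - c) \<bullet> x"
  proof -
    have "(x - c) \<bullet> (\<Sum>p\<in>S. \<kappa> p *\<^sub>R p) = (\<Sum>p\<in>S. \<kappa> p * ((x - c) \<bullet> p))"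
      by (simp only: inner_sum_right inner_scaleR_right)
    then show ?thesis by (simp only: assms(2))
  qed
  have "(\<Sum>p\<in>S. \<kappa> p * (cmod (p - c))\<^sup>2) = (\<Sum>p\<in>S. \<kappa> p * (cmod (p - x))\<^sup>2 + \<kappa> p * (cmod (x - c))\<^sup>2
      + 2 * (\<kappa> p * ((x - c) \<bullet> p)) - \<kappa> p * (2 * ((x - c) \<bullet> x)))"
    by (intro sum.cong refl, subst *) (simp add: algebra_simps)
  also have "\<dots> = (\<Sum>p\<in>S. \<kappa> p * (cmod (p - x))\<^sup>2) + (cmod (x - c))\<^sup>2 + 2 * ((x - c) \<bullet> x) - 2 * ((x - c) \<bullet> x)"
    by (simp only: sum.distrib sum_subtractf sum_distrib_left[symmetric] sum_distrib_right[symmetric] i assms(1) mult_1)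
  finally show ?thesis by simp
qed

text \<open>
  Among all triangles around \<open>x\<close>, choose one that minimises the height over \<open>x\<close> of its lift to the
  paraboloid. A point inside its circumcircle could be exchanged for a vertex, which would
  decrease the height.
\<close>

lemma empty_circumcircle_triangle:
  fixes P :: "complex set"
  assumes P: "finite P" and x: "x \<in> convex hull P"
    and generic: "\<And>p q. p \<in> P \<Longrightarrow> q \<in> P \<Longrightarrow> x \<notin> convex hull {p, q}"
  obtains S c r where "S \<subseteq> P" "card S = 3" "x \<in> convex hull S" "empty_circle P S c r"
proof -
  define F where "F = {S. S \<subseteq> P \<and> card S = 3 \<and> x \<in> convex hull S}"
  have finS: "finite S" if "S \<subseteq> P" for S using that P finite_subset by blast
  have small: "x \<notin> convex hull S" if SP: "S \<subseteq> P" "card S \<le> 2" for S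
  proof (cases "S = {}")
    case False
    then have "\<exists>p\<in>S. \<exists>q\<in>S. S = {p, q}" by (rule card_le_2_subset[OF finS[OF SP(1)] SP(2)])
    then obtain p q where pq: "p \<in> S" "q \<in> S" "S = {p, q}" by (elim bexE)
    then have "p \<in> P" "q \<in> P" using SP by auto
    then show ?thesis unfolding pq(3) by (rule generic)
  qed auto
  obtain S0 where S0: "S0 \<subseteq> P" "card S0 \<le> 3" "x \<in> convex hull S0"
    using x unfolding caratheodory[of P] by auto
  then have "\<not> card S0 \<le> 2" using small by blast
  then have "S0 \<in> F" using S0 by (simp add: F_def)
  have "finite F" by (rule finite_subset[of _ "Pow P"]) (use P in \<open>auto simp: F_def\<close>)
  have circ: "\<exists>c r. r \<ge> 0 \<and> (\<forall>p\<in>S. cmod (p - c) = r)" and aff: "affine hull S = UNIV" if "S \<in> F" for S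
  proof -
    obtain a b d where S: "S = {a, b, d}" "a \<noteq> b" "a \<noteq> d" "b \<noteq> d"
      using \<open>S \<in> F\<close> by (auto simp: F_def card_3_iff)
    have "\<not> collinear {a, b, d}"
    proof
      assume "collinear {a, b, d}"
      then obtain p q where "p \<in> S" "q \<in> S" "x \<in> convex hull {p, q}"
        using collinear_hull_segment[of a b d x] \<open>S \<in> F\<close> unfolding S(1) F_def by blast
      then show False using generic[of p q] \<open>S \<in> F\<close> by (auto simp: F_def)
    qed
    then show "\<exists>c r. r \<ge> 0 \<and> (\<forall>p\<in>S. cmod (p - c) = r)"
      unfolding S by (rule circumcircle_exists) (auto intro!: exI)
    have "\<not> affine_dependent S"
      using \<open>\<not> collinear {a, b, d}\<close> unfolding S(1) collinear_3_eq_affine_dependent by blast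
    then have "aff_dim S = 2"
      using aff_dim_affine_independent[of S] \<open>S \<in> F\<close> by (simp add: F_def)
    then show "affine hull S = UNIV" using aff_dim_eq_full[of S] by simp
  qed
  have "\<forall>S\<in>F. \<exists>l. (\<forall>p\<in>S. 0 \<le> l p) \<and> sum l S = 1 \<and> (\<Sum>p\<in>S. l p *\<^sub>R p) = x"
    using convex_hull_finite[OF finS] by (auto simp: F_def)
  from bchoice[OF this] obtain l where l: "\<And>S p. S \<in> F \<Longrightarrow> p \<in> S \<Longrightarrow> 0 \<le> l S p"
    "\<And>S. S \<in> F \<Longrightarrow> sum (l S) S = 1" "\<And>S. S \<in> F \<Longrightarrow> (\<Sum>p\<in>S. l S p *\<^sub>R p) = x" by blast
  define h where "h = (\<lambda>S. \<Sum>p\<in>S. l S p * (cmod (p - x))\<^sup>2)"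
  have "Min (h ` F) \<in> h ` F" using \<open>finite F\<close> \<open>S0 \<in> F\<close> by (intro Min_in) auto
  then obtain S where S: "S \<in> F" "h S = Min (h ` F)" by auto
  have hmin: "h S \<le> h T" if "T \<in> F" for T using S(2) that \<open>finite F\<close> by simp
  have hval: "(\<Sum>p\<in>T. \<kappa> p * (cmod (p - x))\<^sup>2) = r\<^sup>2 - (cmod (x - c))\<^sup>2"
    if "sum \<kappa> T = 1" "(\<Sum>p\<in>T. \<kappa> p *\<^sub>R p) = x" "\<forall>p\<in>T. cmod (p - c) = r" for T \<kappa> c r
    using sum_power_of_point[OF that(1,2), of c] that(1,3) by (simp add: sum_distrib_right[symmetric])
  obtain c r where cr: "r \<ge> 0" "\<forall>p\<in>S. cmod (p - c) = r" using circ[OF S(1)] by blast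
  have SP: "S \<subseteq> P" "card S = 3" "x \<in> convex hull S" "finite S" using S(1) finS by (auto simp: F_def)
  have "r \<le> cmod (d - c)" if d: "d \<in> P" for d
  proof (rule ccontr)
    assume dr: "\<not> r \<le> cmod (d - c)"
    then have dS: "d \<notin> S" using cr(2) by auto
    have pos: "l S p > 0" if "p \<in> S" for p
    proof (rule ccontr)
      assume "\<not> l S p > 0"
      then have 0: "l S p = 0" using l(1)[OF S(1) that] by simp
      then have "sum (l S) (S - {p}) = 1" "(\<Sum>q\<in>S - {p}. l S q *\<^sub>R q) = x"
        using l(2,3)[OF S(1)] sum.remove[OF SP(4) that, of "l S"] sum.remove[OF SP(4) that, of "\<lambda>q. l S q *\<^sub>R q"] by simp_all
      then have "x \<in> convex hull (S - {p})"
        using convex_hull_finite[of "S - {p}"] SP(4) l(1)[OF S(1)] by auto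
      then show False using small[of "S - {p}"] SP that by auto
    qed
    have "d \<in> affine hull S" using aff[OF S(1)] by simp
    then obtain m where m: "sum m S = 1" "(\<Sum>p\<in>S. m p *\<^sub>R p) = d"
      unfolding affine_hull_finite[OF SP(4)] by blast
    obtain i \<nu> where i: "i \<in> S" "\<And>p. p \<in> insert d (S - {i}) \<Longrightarrow> \<nu> p \<ge> 0" "\<nu> d > 0"
      "sum \<nu> (insert d (S - {i})) = 1" "(\<Sum>p\<in>insert d (S - {i}). \<nu> p *\<^sub>R p) = x"
      by (rule exchange_triangle[OF SP(4) pos l(2,3)[OF S(1)] m dS]) blast+
    let ?T = "insert d (S - {i})"
    have "x \<in> convex hull ?T"
      using convex_hull_finite[of ?T] SP(4) i(2,4,5) by auto
    moreover have "card ?T = 3" using SP(2,4) dS i(1) by simp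
    ultimately have T: "?T \<in> F" using SP(1) d by (auto simp: F_def)
    obtain c' r' where cr': "\<forall>p\<in>?T. cmod (p - c') = r'" using circ[OF T] by blast
    have "h ?T = (\<Sum>p\<in>?T. \<nu> p * (cmod (p - x))\<^sup>2)"
      unfolding h_def hval[OF l(2,3)[OF T] cr'] hval[OF i(4,5) cr'] ..
    also have "\<dots> = (\<Sum>p\<in>?T. \<nu> p * (cmod (p - c))\<^sup>2) - (cmod (x - c))\<^sup>2"
      using sum_power_of_point[OF i(4,5), of c] by simp
    also have "(\<Sum>p\<in>?T. \<nu> p * (cmod (p - c))\<^sup>2) < (\<Sum>p\<in>?T. \<nu> p * r\<^sup>2)"
    proof (rule sum_strict_mono_ex1)
      have "cmod (p - c) \<le> r" if "p \<in> ?T" for p using that cr dr by auto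
      then show "\<forall>p\<in>?T. \<nu> p * (cmod (p - c))\<^sup>2 \<le> \<nu> p * r\<^sup>2"
        using i(2) by (auto intro!: mult_left_mono power_mono)
      have "(cmod (d - c))\<^sup>2 < r\<^sup>2" using dr by (intro power_strict_mono) auto
      then show "\<exists>p\<in>?T. \<nu> p * (cmod (p - c))\<^sup>2 < \<nu> p * r\<^sup>2" using i(3) by auto
    qed (use SP(4) in auto)
    also have "(\<Sum>p\<in>?T. \<nu> p * r\<^sup>2) = r\<^sup>2" using i(4) by (simp only: sum_distrib_right[symmetric] mult_1)
    also have "r\<^sup>2 - (cmod (x - c))\<^sup>2 = h S"
      unfolding h_def using hval[OF l(2,3)[OF S(1)] cr(2)] by simp
    finally show False using hmin[OF T] by simp
  qed
  then have "empty_circle P S c r" using cr by (auto simp: empty_circle_def)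
  then show ?thesis using that[OF SP(1-3)] by blast
qed

subsection \<open>Uniqueness of the Delaunay triangulation\<close>

lemma straight_line_graph_simps [simp]:
  "verts (straight_line_graph P E) = P" "edges (straight_line_graph P E) = E"
  "place (straight_line_graph P E) = (\<lambda>p. p)" "curve (straight_line_graph P E) = (\<lambda>e. convex hull e)"
  by (simp_all add: straight_line_graph_def)

lemma plane_straight_line_graph_iff:
  "is_plane_graph (straight_line_graph P E) \<longleftrightarrow> straight_line_edges P E"
proof
  assume pl: "is_plane_graph (straight_line_graph P E)"
  show "straight_line_edges P E"
  proof
    show "finite P" using pl by (simp add: is_plane_graph_def)
    show "e \<subseteq> P" "card e = 2" if "e \<in> E" for e using pl that by (simp_all add: is_plane_graph_def)
    show "p \<in> e" if "e \<in> E" "p \<in> P" "p \<in> convex hull e" for e p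
    proof -
      have "convex hull e \<inter> P = e" using pl that(1) by (simp add: is_plane_graph_def)
      then show ?thesis using that by blast
    qed
    show "convex hull e \<inter> convex hull e' \<subseteq> e \<inter> e'" if "e \<in> E" "e' \<in> E" "e \<noteq> e'" for e e'
      using pl that by (simp add: is_plane_graph_def)
  qed
next
  assume "straight_line_edges P E"
  then interpret straight_line_edges P E .
  have "\<exists>g. arc g \<and> pathstart g = u \<and> pathfinish g = v \<and> path_image g = convex hull {u, v}" if "{u, v} \<in> E" for u v
  proof -
    have "u \<noteq> v" using edge_card[OF that] by auto
    then show ?thesis by (intro exI[of _ "linepath u v"]) (simp add: arc_linepath segment_convex_hull)
  qed
  moreover have "convex hull e \<inter> P = e" if "e \<in> E" for e
    using edge_points[OF that] edge_subset[OF that] hull_subset[of e convex] by blast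
  ultimately show "is_plane_graph (straight_line_graph P E)"
    using finite_points edge_subset edge_card edge_inter by (simp add: is_plane_graph_def)
qed

lemma empty_circle_mono: "empty_circle P S c r \<Longrightarrow> T \<subseteq> S \<Longrightarrow> empty_circle P T c r"
  by (auto simp: empty_circle_def)

locale delaunay_polygon =
  fixes P :: "complex set" and E :: "complex set set" and H :: "complex set"
  assumes finite_P: "finite P"
    and edge_subset: "e \<in> E \<Longrightarrow> e \<subseteq> P"
    and edge_card: "e \<in> E \<Longrightarrow> card e = 2"
    and edge_circle: "e \<in> E \<Longrightarrow> \<exists>c r. strictly_empty_circle P e c r"
    and polygon: "supporting_polygon P H" "H \<noteq> {}"
    and many_edges: "3 * card P \<le> card E + card H + 3"
    and full_hull: "interior (convex hull P) \<noteq> {}"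
begin

lemma finite_E: "finite E"
  by (rule finite_subset[of _ "Pow P"]) (use edge_subset finite_P in auto)

lemma edge_weak_circle: "e \<in> E \<Longrightarrow> \<exists>c r. empty_circle P e c r"
  using edge_circle by (meson strictly_empty_circle_def)

lemma edge_inter_weak:
  assumes "e \<in> E" "e' \<subseteq> P" "card e' = 2" "empty_circle P e' c r" "e \<noteq> e'"
  shows "convex hull e \<inter> convex hull e' \<subseteq> e \<inter> e'"
proof -
  obtain c0 r0 where "strictly_empty_circle P e c0 r0" using edge_circle[OF assms(1)] by auto
  from delaunay_edges_noncrossing[OF edge_subset[OF assms(1)] edge_card[OF assms(1)] this assms(2-5)]
  show ?thesis .
qed

lemma straight_line_edges_insert:
  assumes e: "e \<subseteq> P" "card e = 2" "empty_circle P e c r"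
  shows "straight_line_edges P (insert e E)"
proof
  show "finite P" by (rule finite_P)
  show "f \<subseteq> P" "card f = 2" if "f \<in> insert e E" for f
    using that e edge_subset edge_card by auto
  show "p \<in> f" if f: "f \<in> insert e E" and p: "p \<in> P" "p \<in> convex hull f" for f p
  proof -
    obtain c r where "empty_circle P f c r" using f e(3) edge_weak_circle[of f] by auto
    from empty_circle_points[OF this p] show ?thesis .
  qed
  show "convex hull f \<inter> convex hull f' \<subseteq> f \<inter> f'" if f: "f \<in> insert e E" "f' \<in> insert e E" "f \<noteq> f'" for f f'
  proof (cases "f \<in> E")
    case True
    obtain c' r' where "empty_circle P f' c' r'" using f(2) e(3) edge_weak_circle[of f'] by auto
    moreover have "f' \<subseteq> P" "card f' = 2" using f(2) e edge_subset edge_card by auto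
    ultimately show ?thesis using edge_inter_weak[OF True] f(3) by blast
  next
    case False
    then have "f = e" "f' \<in> E" using f by auto
    then show ?thesis using edge_inter_weak[OF _ e, of f'] f(3) by blast
  qed
qed

lemma weak_edge_in:
  assumes e: "e \<subseteq> P" "card e = 2" "empty_circle P e c r"
  shows "e \<in> E"
proof (rule ccontr)
  assume "e \<notin> E"
  then have "card (insert e E) = card E + 1" using finite_E by simp
  moreover have "card (insert e E) + card H + 3 \<le> 3 * card P"
    by (rule straight_line_edges.card_edges_upper[OF straight_line_edges_insert[OF e] polygon])
  ultimately show False using many_edges by linarith
qed

lemma straight_line: "straight_line_edges P E"
proof (cases "E = {}")
  case True
  then show ?thesis by unfold_locales (use finite_P in auto)
next
  case False
  then obtain e where e: "e \<in> E" by auto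
  obtain c r where "empty_circle P e c r" using edge_weak_circle[OF e] by auto
  from straight_line_edges_insert[OF edge_subset[OF e] edge_card[OF e] this] show ?thesis
    using e by (simp add: insert_absorb)
qed

definition lines :: "complex set" where
  "lines = P \<union> (\<Union>e\<in>E. convex hull e)"

lemma drawing_eq: "drawing (straight_line_graph P E) = lines"
  by (simp add: drawing_def lines_def)

lemma lines_hull: "lines \<subseteq> convex hull P"
  unfolding lines_def using hull_mono[OF edge_subset, of _ convex] hull_subset[of P convex] by blast

lemma compact_lines: "compact lines"
proof -
  have "compact (convex hull e)" if "e \<in> E" for e
    using edge_subset[OF that] finite_P finite_subset by (intro finite_imp_compact_convex_hull) blast
  then have "compact (\<Union>e\<in>E. convex hull e)" using finite_E by (intro compact_UN) auto
  then show ?thesis unfolding lines_def by (rule compact_Un[OF finite_imp_compact[OF finite_P]])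
qed

lemma generic_point:
  assumes "open U" "U \<noteq> {}"
  obtains x where "x \<in> U" "\<And>p q. p \<in> P \<Longrightarrow> q \<in> P \<Longrightarrow> x \<notin> convex hull {p, q}"
proof -
  define L where "L = \<Union>((\<lambda>(p, q). convex hull {p, q}) ` (P \<times> P))"
  have "interior L = {}"
    unfolding L_def using finite_P
    by (intro interior_Union_closed_empty)
       (auto simp: interior_closed_segment_ge2 segment_convex_hull[symmetric])
  then have "\<not> U \<subseteq> L" using assms interior_maximal by blast
  then obtain x where "x \<in> U" "x \<notin> L" by auto
  then show ?thesis using that by (auto simp: L_def)
qed

text \<open>The witness for each generic point of the hull is its triangle with empty circumcircle.\<close>

lemma generic_point_face:
  assumes f: "f \<in> components (- lines)" "x \<in> f" "x \<in> convex hull P"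
    and generic: "\<And>p q. p \<in> P \<Longrightarrow> q \<in> P \<Longrightarrow> x \<notin> convex hull {p, q}"
  obtains a b d where "a \<noteq> b" "b \<noteq> d" "d \<noteq> a" "{{a, b}, {b, d}, {d, a}} \<subseteq> E" "{a, b, d} \<subseteq> P"
    "f = interior (convex hull {a, b, d})"
    "frontier f = (\<Union>e\<in>{{a, b}, {b, d}, {d, a}}. convex hull e)"
proof -
  obtain S c r where S: "S \<subseteq> P" "card S = 3" "x \<in> convex hull S" "empty_circle P S c r"
    by (rule empty_circumcircle_triangle[OF finite_P f(3) generic])
  obtain a b d where abd: "S = {a, b, d}" "a \<noteq> b" "a \<noteq> d" "b \<noteq> d"
    using S(2) unfolding card_3_iff by (elim exE conjE)
  have inE: "{p, q} \<in> E" if "p \<in> S" "q \<in> S" "p \<noteq> q" for p q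
    by (rule weak_edge_in[OF _ _ empty_circle_mono[OF S(4)]]) (use that S(1) in auto)
  have E3: "{{a, b}, {b, d}, {d, a}} \<subseteq> E" using inE abd by auto
  define T where "T = convex hull S"
  have frT: "frontier T = (\<Union>e\<in>{{a, b}, {b, d}, {d, a}}. convex hull e)"
    unfolding T_def abd(1) by (simp add: frontier_of_triangle segment_convex_hull Un_assoc)
  have frL: "frontier T \<subseteq> lines" unfolding frT lines_def using E3 by blast
  have "x \<notin> frontier T" using generic S(1) abd(1) unfolding frT by auto
  moreover have clT: "closed T"
    unfolding T_def using S(1) finite_P finite_subset
    by (intro compact_imp_closed finite_imp_compact_convex_hull) blast
  ultimately have xT: "x \<in> interior T" using S(3) by (auto simp: frontier_def T_def)
  have TP: "p \<in> S" if "p \<in> P" "p \<in> T" for p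
    using empty_circle_points[OF S(4)] that by (simp add: T_def)
  have Sfr: "S \<subseteq> frontier T"
    unfolding frT abd(1) using hull_subset[of "{a, b}" convex] hull_subset[of "{b, d}" convex] by auto
  have int_frontier: "z \<notin> frontier T" if "z \<in> interior T" for z using that by (simp add: frontier_def)
  have disj: "interior T \<inter> lines = {}"
  proof (rule ccontr)
    assume "\<not> ?thesis"
    then obtain z where z: "z \<in> interior T" "z \<in> lines" by auto
    have zP: "z \<notin> P" using TP[of z] Sfr z(1) interior_subset[of T] int_frontier by auto
    then obtain e where e: "e \<in> E" "z \<in> convex hull e" using z(2) by (auto simp: lines_def)
    have endT: "p \<in> T" if p: "p \<in> e" for p
    proof (rule ccontr)
      assume "p \<notin> T"
      then have "closed_segment z p \<inter> frontier T \<noteq> {}"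
        using z(1) interior_subset[of T] by (intro connected_Int_frontier) auto
      then obtain y where y: "y \<in> closed_segment z p" "y \<in> frontier T" by auto
      have "closed_segment z p \<subseteq> convex hull e"
        using e(2) p hull_inc[of p e convex] by (intro closed_segment_subset) auto
      then have ye: "y \<in> convex hull e" using y(1) by auto
      obtain g where g: "g \<in> {{a, b}, {b, d}, {d, a}}" "y \<in> convex hull g" using y(2) unfolding frT by auto
      have gE: "g \<in> E" using g(1) E3 by auto
      have "e \<noteq> g"
      proof
        assume "e = g"
        then have "z \<in> frontier T" using e(2) g(1) unfolding frT by auto
        then show False using int_frontier z(1) by simp
      qed
      then have "y \<in> e \<inter> g" using straight_line_edges.edge_inter[OF straight_line e(1) gE] ye g(2) by blast
      then have "y \<in> e" "y \<in> T" using y(2) clT by (auto simp: frontier_def)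
      then have "y \<noteq> p" using \<open>p \<notin> T\<close> by auto
      then have "e = {y, p}" using \<open>y \<in> e\<close> p edge_card[OF e(1)] by (auto simp: card_2_iff)
      then have "z \<in> closed_segment y p" using e(2) by (simp add: segment_convex_hull)
      then have "dist y p = dist y z + dist z p" "dist z p = dist z y + dist y p"
        using y(1) by (simp_all add: between_mem_segment[symmetric] between)
      then have "z = y" by (simp add: dist_commute)
      then show False using y(2) int_frontier z(1) by simp
    qed
    have "e \<subseteq> S" using endT TP edge_subset[OF e(1)] by blast
    then have "e \<in> {{a, b}, {b, d}, {d, a}}"
      using edge_card[OF e(1)] abd(1) by (auto simp: card_2_iff)
    then have "z \<in> frontier T" using e(2) unfolding frT by auto
    then show False using int_frontier z(1) by simp
  qed
  have cvT: "convex T" by (simp add: T_def)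
  have clo: "closure (interior T) = T"
    using convex_closure_interior[OF cvT] xT clT by auto
  have frI: "frontier (interior T) = frontier T"
    using clo clT by (simp add: frontier_def)
  have fI: "f = interior T"
  proof
    show "interior T \<subseteq> f"
      by (rule components_maximal[OF f(1)]) (use cvT disj xT f(2) in \<open>auto simp: convex_connected\<close>)
    show "f \<subseteq> interior T"
    proof (rule ccontr)
      assume "\<not> ?thesis"
      then have "f \<inter> frontier (interior T) \<noteq> {}"
        using xT f(2) in_components_connected[OF f(1)] by (intro connected_Int_frontier) auto
      then show False using frI frL in_components_subset[OF f(1)] by auto
    qed
  qed
  show ?thesis
    by (rule that[OF abd(2,4) abd(3)[symmetric] E3]) (use S(1) abd(1) fI frI frT in \<open>simp_all add: T_def\<close>)
qed

lemma outside_lines: "outside lines = - (convex hull P)"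
proof
  have bd: "bounded (convex hull P)" using finite_P by (simp add: bounded_convex_hull finite_imp_bounded)
  have con: "connected (- (convex hull P))"
    by (rule connected_complement_bounded_convex[OF bd]) auto
  show "- (convex hull P) \<subseteq> outside lines"
  proof
    fix y assume y: "y \<in> - (convex hull P)"
    then have "- (convex hull P) \<subseteq> connected_component_set (- lines) y"
      using con lines_hull by (intro connected_component_maximal) auto
    moreover have "\<not> bounded (- (convex hull P))"
    proof
      assume "bounded (- (convex hull P))"
      with bd have "bounded (convex hull P \<union> - (convex hull P))" by (simp only: bounded_Un simp_thms)
      moreover have "\<not> bounded (convex hull P \<union> - (convex hull P))"
        unfolding Compl_partition by (rule not_bounded_UNIV)
      ultimately show False by (rule notE[rotated])
    qed
    ultimately have "\<not> bounded (connected_component_set (- lines) y)" using bounded_subset by blast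
    then show "y \<in> outside lines" using y lines_hull by (auto simp: outside_def)
  qed
  show "outside lines \<subseteq> - (convex hull P)"
  proof
    fix y assume y: "y \<in> outside lines"
    show "y \<in> - (convex hull P)"
    proof (rule ccontr)
      assume "y \<notin> - (convex hull P)"
      then have yh: "y \<in> convex hull P" by simp
      define f where "f = connected_component_set (- lines) y"
      have yl: "y \<in> - lines" using y by (auto simp: outside_def)
      have unb: "\<not> bounded f" using y by (simp add: outside_def f_def)
      have fc: "f \<in> components (- lines)" unfolding f_def using yl by (simp add: componentsI)
      have opf: "open f" by (rule open_components[OF _ fc]) (use compact_lines in \<open>auto simp: compact_imp_closed\<close>)
      have "y \<in> f" using yl by (simp add: f_def)
      moreover have "y \<in> closure (interior (convex hull P))"
        using yh convex_closure_interior[OF convex_convex_hull full_hull] closure_subset by blast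
      ultimately have "f \<inter> interior (convex hull P) \<noteq> {}"
        using opf open_Int_closure_eq_empty[OF opf, of "interior (convex hull P)"] by blast
      then obtain x where x: "x \<in> f \<inter> interior (convex hull P)"
        "\<And>p q. p \<in> P \<Longrightarrow> q \<in> P \<Longrightarrow> x \<notin> convex hull {p, q}"
        using generic_point[of "f \<inter> interior (convex hull P)"] opf by (metis open_Int open_interior)
      have "x \<in> f" "x \<in> convex hull P" using x(1) interior_subset by auto
      then obtain a b d where "f = interior (convex hull {a, b, d})"
        using generic_point_face[OF fc _ _ x(2)] by metis
      then have "bounded f"
        by (metis bounded_convex_hull bounded_interior finite.emptyI finite_imp_bounded finite_insert)
      then show False using unb by simp
    qed
  qed
qed

lemma triangulation: "is_triangulation (straight_line_graph P E)"
  unfolding is_triangulation_def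
proof (intro conjI ballI impI)
  show "is_plane_graph (straight_line_graph P E)"
    using straight_line by (simp add: plane_straight_line_graph_iff)
  fix f assume f: "f \<in> faces (straight_line_graph P E)" "bounded f"
  have fc: "f \<in> components (- lines)" using f(1) by (simp add: faces_def drawing_eq)
  have opf: "open f" by (rule open_components[OF _ fc]) (use compact_lines in \<open>auto simp: compact_imp_closed\<close>)
  have fne: "f \<noteq> {}" using in_components_nonempty[OF fc] .
  obtain x where x: "x \<in> f" "\<And>p q. p \<in> P \<Longrightarrow> q \<in> P \<Longrightarrow> x \<notin> convex hull {p, q}"
    by (rule generic_point[OF opf fne]) blast
  have "x \<in> convex hull P"
  proof (rule ccontr)
    assume "x \<notin> convex hull P"
    then have "x \<in> outside lines" by (simp add: outside_lines)
    moreover have "f = connected_component_set (- lines) x"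
      using fc x(1) by (metis components_iff connected_component_eq)
    ultimately show False using f(2) by (simp add: outside_def)
  qed
  then obtain a b d where abd: "a \<noteq> b" "b \<noteq> d" "d \<noteq> a" "{{a, b}, {b, d}, {d, a}} \<subseteq> E" "{a, b, d} \<subseteq> P"
    "frontier f = (\<Union>e\<in>{{a, b}, {b, d}, {d, a}}. convex hull e)"
    by (rule generic_point_face[OF fc x(1) _ x(2)])
  show "\<exists>c. length c = 3 \<and> bounded_by_cycle (straight_line_graph P E) f c"
    by (rule exI[of _ "[a, b, d]"])
       (use abd in \<open>simp add: bounded_by_cycle_def is_cycle_def cycle_edges_3\<close>)
qed

lemma strict_edge_delaunay: "E \<subseteq> delaunay_edges P"
proof
  fix e assume e: "e \<in> E"
  obtain p q where pq: "e = {p, q}" "p \<noteq> q" using edge_card[OF e] by (meson card_2_iff)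
  obtain c r where cr: "strictly_empty_circle P e c r" using edge_circle[OF e] by auto
  then have on: "cmod (s - c) = r" if "s \<in> e" for s
    using that by (simp add: strictly_empty_circle_def empty_circle_def)
  have off: "r < cmod (s - c)" if "s \<in> P - e" for s
    using cr that by (simp add: strictly_empty_circle_def)
  have wk: "r \<le> cmod (s - c)" if "s \<in> P" for s
    using cr that by (simp add: strictly_empty_circle_def empty_circle_def)
  have "r > 0"
  proof (rule ccontr)
    assume "\<not> r > 0"
    then have "cmod (p - c) \<le> 0" "cmod (q - c) \<le> 0" using on pq by auto
    then show False using pq(2) by simp
  qed
  moreover have "sphere c r \<inter> P = {p, q}"
    using on off edge_subset[OF e] pq(1) by (force simp: dist_norm norm_minus_commute)
  moreover have "ball c r \<inter> P = {}"
    using wk by (force simp: dist_norm norm_minus_commute)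
  ultimately show "e \<in> delaunay_edges P"
    unfolding delaunay_edges_def using pq edge_subset[OF e] by blast
qed

lemma delaunay_edges_subset: "delaunay_edges P \<subseteq> E"
proof
  fix e assume "e \<in> delaunay_edges P"
  then obtain p q c r where e: "e = {p, q}" "p \<in> P" "q \<in> P" "p \<noteq> q" "r > 0"
    "sphere c r \<inter> P = {p, q}" "ball c r \<inter> P = {}"
    unfolding delaunay_edges_def by blast
  have "p \<in> sphere c r" "q \<in> sphere c r" using e(6) by auto
  then have "empty_circle P e c r"
    using e(1,5,7) by (auto simp: empty_circle_def dist_norm norm_minus_commute disjoint_iff not_less)
  then show "e \<in> E" by (rule weak_edge_in[rotated 2]) (use e in auto)
qed

lemma delaunay_triangulations_eq: "delaunay_triangulations P = {straight_line_graph P E}"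
proof
  show "{straight_line_graph P E} \<subseteq> delaunay_triangulations P"
  proof -
    have "outer_face (straight_line_graph P E) = - (convex hull P)"
      by (simp add: outer_face_def drawing_eq outside_lines)
    then have "frontier (outer_face (straight_line_graph P E)) = frontier (convex hull P)"
      by (simp add: frontier_complement)
    then show ?thesis using triangulation delaunay_edges_subset by (auto simp: delaunay_triangulations_def)
  qed
  show "delaunay_triangulations P \<subseteq> {straight_line_graph P E}"
  proof
    fix T assume "T \<in> delaunay_triangulations P"
    then obtain E' where E': "T = straight_line_graph P E'" "delaunay_edges P \<subseteq> E'" "is_triangulation T"
      unfolding delaunay_triangulations_def by blast
    then have sl: "straight_line_edges P E'"
      using plane_straight_line_graph_iff by (simp add: is_triangulation_def)
    have "E \<subseteq> E'" using strict_edge_delaunay E'(2) by blast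
    moreover have "card E' \<le> card E"
      using straight_line_edges.card_edges_upper[OF sl polygon] many_edges by linarith
    ultimately have "E = E'"
      using straight_line_edges.finite_edges[OF sl] by (intro card_seteq)
    then show "T \<in> {straight_line_graph P E}" using E'(1) by simp
  qed
qed

lemma polygon_frontier:
  assumes "u \<in> H"
  shows "u \<in> frontier (convex hull P)"
proof -
  have uP: "u \<in> P" using assms polygon by (auto simp: supporting_polygon_def)
  have "\<exists>v\<in>H. v \<noteq> u \<and> (\<forall>w\<in>P. Con u w v \<le> 0)"
    using polygon(1) assms by (simp add: supporting_polygon_def)
  then obtain v where v: "v \<noteq> u" "\<And>w. w \<in> P \<Longrightarrow> Con u w v \<le> 0" by blast
  have "u \<notin> interior (convex hull P)"
  proof
    assume "u \<in> interior (convex hull P)"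
    then obtain \<epsilon> where \<epsilon>: "\<epsilon> > 0" "ball u \<epsilon> \<subseteq> convex hull P" by (meson mem_interior)
    define \<delta> where "\<delta> = v - u"
    define s where "s = \<epsilon> / (2 * cmod \<delta>)"
    have s: "s > 0" using \<epsilon>(1) v(1) by (simp add: s_def \<delta>_def)
    define z where "z = u + of_real s * \<i> * \<delta>"
    have "dist u z = \<epsilon> / 2" using s v(1) \<epsilon>(1) by (simp add: z_def dist_norm norm_mult norm_divide s_def \<delta>_def)
    then have "z \<in> convex hull P" using \<epsilon> by (auto simp: subset_iff)
    then have "Con u z v \<le> 0" using Con_convex_hull v(2) by blast
    moreover have "Con u z v = s * (cmod \<delta>)\<^sup>2"
    proof -
      have v_eq: "v = u + \<delta>" by (simp add: \<delta>_def)
      show ?thesis unfolding z_def v_eq cmod_power2 Con_def by (simp add: algebra_simps power2_eq_square)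
    qed
    moreover have "s * (cmod \<delta>)\<^sup>2 > 0" using s v(1) by (simp add: \<delta>_def)
    ultimately show False by simp
  qed
  then show ?thesis using hull_inc[OF uP, of convex] closure_subset by (auto simp: frontier_def)
qed

end

subsection \<open>Realizations and their perturbations\<close>

definition edge_centre :: "'a plane_graph \<Rightarrow> ('a \<Rightarrow> complex) \<Rightarrow> 'a set \<Rightarrow> complex \<Rightarrow> bool" where
  "edge_centre G p e c \<longleftrightarrow> (\<forall>i\<in>e. (\<forall>j\<in>e. cmod (p j - c) = cmod (p i - c)) \<and>
     (\<forall>k\<in>verts G - e. cmod (p i - c) < cmod (p k - c)))"

definition realization :: "'a plane_graph \<Rightarrow> 'a list \<Rightarrow> ('a \<Rightarrow> complex) \<Rightarrow> bool" where
  "realization G C p \<longleftrightarrow>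
     (\<forall>t<length C. Con (p (cyc_nth C t)) (p (cyc_nth C (t + 1))) (p (cyc_nth C (t + 2))) > 0) \<and>
     (\<forall>t<length C. \<forall>k\<in>verts G - {cyc_nth C t, cyc_nth C (t + 1)}.
        Con (p (cyc_nth C t)) (p k) (p (cyc_nth C (t + 1))) < 0) \<and>
     (\<forall>e\<in>edges G. \<exists>c. edge_centre G p e c)"

lemma cmod_diff_compare:
  "cmod (a - c) < cmod (b - c) \<longleftrightarrow>
    (Re b)\<^sup>2 - (Re a)\<^sup>2 + (Im b)\<^sup>2 - (Im a)\<^sup>2 - 2 * Re c * Re b - 2 * Im c * Im b + 2 * Re c * Re a + 2 * Im c * Im a > 0"
  "cmod (a - c) = cmod (b - c) \<longleftrightarrow>
    (Re a)\<^sup>2 - (Re b)\<^sup>2 + (Im a)\<^sup>2 - (Im b)\<^sup>2 - 2 * Re c * Re a - 2 * Im c * Im a + 2 * Re c * Re b + 2 * Im c * Im b = 0"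
proof -
  have "(cmod (x - c))\<^sup>2 = (Re x)\<^sup>2 + (Im x)\<^sup>2 - 2 * Re c * Re x - 2 * Im c * Im x + (Re c)\<^sup>2 + (Im c)\<^sup>2" for x
    unfolding cmod_power2 by (simp add: power2_eq_square algebra_simps)
  note sq = this[of a] this[of b]
  have "cmod (a - c) < cmod (b - c) \<longleftrightarrow> (cmod (a - c))\<^sup>2 < (cmod (b - c))\<^sup>2"
    by (auto intro: power_strict_mono power2_less_imp_less)
  then show "cmod (a - c) < cmod (b - c) \<longleftrightarrow>
    (Re b)\<^sup>2 - (Re a)\<^sup>2 + (Im b)\<^sup>2 - (Im a)\<^sup>2 - 2 * Re c * Re b - 2 * Im c * Im b + 2 * Re c * Re a + 2 * Im c * Im a > 0"
    unfolding sq by linarith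
  have "cmod (a - c) = cmod (b - c) \<longleftrightarrow> (cmod (a - c))\<^sup>2 = (cmod (b - c))\<^sup>2" by simp
  then show "cmod (a - c) = cmod (b - c) \<longleftrightarrow>
    (Re a)\<^sup>2 - (Re b)\<^sup>2 + (Im a)\<^sup>2 - (Im b)\<^sup>2 - 2 * Re c * Re a - 2 * Im c * Im a + 2 * Re c * Re b + 2 * Im c * Im b = 0"
    unfolding sq by linarith
qed

lemma edge_centre_doubleton:
  "edge_centre G p {i, j} c \<longleftrightarrow> cmod (p i - c) = cmod (p j - c) \<and>
    (\<forall>k\<in>verts G - {i, j}. cmod (p i - c) < cmod (p k - c))"
  by (auto simp: edge_centre_def)

lemma realization_iff:
  assumes "is_plane_graph G"
  shows "realization G C p \<longleftrightarrow> (\<exists>S. solves_Const G C S \<and> point S = p)"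
proof
  assume R: "realization G C p"
  then have "\<forall>e\<in>edges G. \<exists>c. edge_centre G p e c" by (simp add: realization_def)
  from bchoice[OF this] obtain c where c: "\<And>e. e \<in> edges G \<Longrightarrow> edge_centre G p e (c e)" by blast
  define S where "S = \<lparr>vert_x = (\<lambda>i. Re (p i)), vert_y = (\<lambda>i. Im (p i)),
    edge_x = (\<lambda>e. Re (c e)), edge_y = (\<lambda>e. Im (c e))\<rparr>"
  have pS: "point S = p" by (rule ext) (simp add: point_def S_def)
  have "solves_Const G C S"
    unfolding solves_Const_def pS
  proof (intro conjI allI impI)
    fix i j assume e: "{i, j} \<in> edges G"
    note * = c[OF e, unfolded edge_centre_doubleton cmod_diff_compare]
    show "(vert_x S i)\<^sup>2 - (vert_x S j)\<^sup>2 + (vert_y S i)\<^sup>2 - (vert_y S j)\<^sup>2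
          - 2 * edge_x S {i, j} * vert_x S i - 2 * edge_y S {i, j} * vert_y S i
          + 2 * edge_x S {i, j} * vert_x S j + 2 * edge_y S {i, j} * vert_y S j = 0"
      using * by (simp add: S_def)
    show "\<forall>k\<in>verts G - {i, j}.
           (vert_x S k)\<^sup>2 - (vert_x S i)\<^sup>2 + (vert_y S k)\<^sup>2 - (vert_y S i)\<^sup>2
             - 2 * edge_x S {i, j} * vert_x S k - 2 * edge_y S {i, j} * vert_y S k
             + 2 * edge_x S {i, j} * vert_x S i + 2 * edge_y S {i, j} * vert_y S i > 0"
      using * by (simp add: S_def)
  qed (use R in \<open>simp_all add: realization_def\<close>)
  then show "\<exists>S. solves_Const G C S \<and> point S = p" using pS by blast
next
  assume "\<exists>S. solves_Const G C S \<and> point S = p"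
  then obtain S where S: "solves_Const G C S" "p = point S" by blast
  have ex: "\<exists>c. edge_centre G p e c" if e: "e \<in> edges G" for e
  proof -
    have "card e = 2" using assms e by (simp add: is_plane_graph_def)
    then obtain i j where ij: "e = {i, j}" by (meson card_2_iff)
    have ijE: "{i, j} \<in> edges G" using e ij by simp
    have "edge_centre G p {i, j} (Complex (edge_x S {i, j}) (edge_y S {i, j}))"
      unfolding edge_centre_doubleton cmod_diff_compare S(2)
      using S(1)[unfolded solves_Const_def] ijE by (simp add: point_def)
    then show ?thesis unfolding ij by blast
  qed
  note S1 = S(1)[unfolded solves_Const_def, folded S(2)]
  show "realization G C p"
    unfolding realization_def
    by (intro conjI ballI) (rule conjunct1[OF S1], rule conjunct1[OF conjunct2[OF S1]], rule ex)
qed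

lemma realization_scale:
  assumes "realization G C p" "k > (0::real)"
  shows "realization G C (\<lambda>i. of_real k * p i)"
proof -
  have n: "cmod (of_real k * a - of_real k * b) = k * cmod (a - b)" for a b
    unfolding right_diff_distrib[symmetric] norm_mult using assms(2) by simp
  have "edge_centre G (\<lambda>i. of_real k * p i) e (of_real k * c)" if "edge_centre G p e c" for e c
    unfolding edge_centre_def n
  proof (intro ballI conjI)
    fix i j assume "i \<in> e" "j \<in> e"
    then have "cmod (p j - c) = cmod (p i - c)" using that unfolding edge_centre_def by blast
    then show "k * cmod (p j - c) = k * cmod (p i - c)" by (rule arg_cong)
  next
    fix i j assume "i \<in> e" "j \<in> verts G - e"
    then have "cmod (p i - c) < cmod (p j - c)" using that unfolding edge_centre_def by blast
    then show "k * cmod (p i - c) < k * cmod (p j - c)" using assms(2) by simp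
  qed
  then have "\<exists>c. edge_centre G (\<lambda>i. of_real k * p i) e c" if "e \<in> edges G" for e
    using assms(1) that unfolding realization_def by meson
  then show ?thesis
    using assms unfolding realization_def Con_mult by (simp add: mult_less_0_iff)
qed

lemma shifted_centre:
  "(cmod (a - (c + of_real s * (a - b))))\<^sup>2 - (cmod (b - (c + of_real s * (a - b))))\<^sup>2 =
    (cmod (a - c))\<^sup>2 - (cmod (b - c))\<^sup>2 - s * (2 * (cmod (a - b))\<^sup>2)"
  unfolding cmod_power2 by (simp add: power2_eq_square algebra_simps)

text \<open>The circle centre is moved along the edge to keep it equidistant from the two endpoints.\<close>

lemma edge_centre_eventually:
  assumes fin: "finite (verts G)" and c: "edge_centre G p {i, j} c" and ij: "i \<in> verts G" "j \<in> verts G" "p i \<noteq> p j"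
    and lim: "\<And>k. k \<in> verts G \<Longrightarrow> (\<lambda>m. q m k) \<longlonglongrightarrow> p k"
  shows "eventually (\<lambda>m. \<exists>c. edge_centre G (q m) {i, j} c) sequentially"
proof -
  define N where "N = (\<lambda>m. (cmod (q m i - c))\<^sup>2 - (cmod (q m j - c))\<^sup>2)"
  define s where "s = (\<lambda>m. N m / (2 * (cmod (q m i - q m j))\<^sup>2))"
  define c' where "c' = (\<lambda>m. c + of_real (s m) * (q m i - q m j))"
  have "s \<longlonglongrightarrow> ((cmod (p i - c))\<^sup>2 - (cmod (p j - c))\<^sup>2) / (2 * (cmod (p i - p j))\<^sup>2)"
    unfolding s_def N_def using ij by (intro tendsto_intros lim) auto
  then have s0: "s \<longlonglongrightarrow> 0" using c by (simp add: edge_centre_doubleton)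
  have "c' \<longlonglongrightarrow> c + of_real 0 * (p i - p j)"
    unfolding c'_def by (intro tendsto_intros lim s0 ij)
  then have c'lim: "c' \<longlonglongrightarrow> c" by simp
  have eq: "cmod (q m i - c' m) = cmod (q m j - c' m)" for m
  proof (cases "q m i = q m j")
    case False
    then have "s m * (2 * (cmod (q m i - q m j))\<^sup>2) = N m" by (simp add: s_def)
    then have "(cmod (q m i - c' m))\<^sup>2 - (cmod (q m j - c' m))\<^sup>2 = 0"
      unfolding c'_def shifted_centre by (simp add: N_def)
    then show ?thesis by simp
  qed simp
  have "eventually (\<lambda>m. \<forall>k\<in>verts G - {i, j}. cmod (q m i - c' m) < cmod (q m k - c' m)) sequentially"
  proof (rule eventually_ball_finite)
    show "\<forall>k\<in>verts G - {i, j}. eventually (\<lambda>m. cmod (q m i - c' m) < cmod (q m k - c' m)) sequentially"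
    proof
      fix k assume k: "k \<in> verts G - {i, j}"
      have "(\<lambda>m. cmod (q m k - c' m) - cmod (q m i - c' m)) \<longlonglongrightarrow> cmod (p k - c) - cmod (p i - c)"
        using k ij by (intro tendsto_intros lim c'lim) auto
      moreover have "cmod (p i - c) < cmod (p k - c)"
        using c k unfolding edge_centre_doubleton by blast
      then have "0 < cmod (p k - c) - cmod (p i - c)" by simp
      ultimately have "eventually (\<lambda>m. 0 < cmod (q m k - c' m) - cmod (q m i - c' m)) sequentially"
        by (rule order_tendstoD)
      then show "eventually (\<lambda>m. cmod (q m i - c' m) < cmod (q m k - c' m)) sequentially"
        by simp
    qed
  qed (use fin in simp)
  then show ?thesis
  proof (rule eventually_mono)
    fix m assume "\<forall>k\<in>verts G - {i, j}. cmod (q m i - c' m) < cmod (q m k - c' m)"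
    then have "edge_centre G (q m) {i, j} (c' m)" unfolding edge_centre_doubleton using eq[of m] by blast
    then show "\<exists>c. edge_centre G (q m) {i, j} c" by blast
  qed
qed

context cycle_bounded_triangulation
begin

lemma cyc_nth_in: "cyc_nth C t \<in> set C"
  using outer_cycle(1) by (cases "C = []") (auto simp: cyc_nth_def)

lemma cyc_nth_verts: "cyc_nth C t \<in> verts G"
  using cyc_nth_in outer_cycle(3) by blast

lemma realization_inj:
  assumes R: "realization G C p"
  shows "inj_on p (verts G)"
proof (rule inj_onI, rule ccontr)
  fix i j assume ij: "i \<in> verts G" "j \<in> verts G" "p i = p j" "i \<noteq> j"
  have sep: False if e: "{u, w} \<in> edges G" "u \<in> {i, j}" "w \<notin> {i, j}" for u w
  proof -
    obtain c where c: "edge_centre G p {u, w} c" using R e(1) by (auto simp: realization_def)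
    have "i \<in> verts G - {u, w} \<and> p i = p u \<or> j \<in> verts G - {u, w} \<and> p j = p u"
      using e(2,3) ij by auto
    then obtain v where v: "v \<in> verts G - {u, w}" "p v = p u" by blast
    then have "cmod (p u - c) < cmod (p v - c)" using c unfolding edge_centre_def by blast
    then show False using v(2) by simp
  qed
  have ijV: "{i, j} = verts G"
    by (rule connected_verts) (use ij sep in blast)+
  have "card (set C) \<le> card (verts G)" by (rule card_mono[OF finite_verts outer_cycle(3)])
  also have "\<dots> = card {i, j}" by (simp only: ijV)
  also have "\<dots> \<le> 2" by (simp add: card_insert_if)
  finally show False using outer_cycle(1,2) distinct_card[of C] by simp
qed

lemma realization_open:
  assumes R: "realization G C p"
  obtains \<epsilon> where "\<epsilon> > 0" "\<And>q. (\<And>i. i \<in> verts G \<Longrightarrow> cmod (q i - p i) \<le> \<epsilon>) \<Longrightarrow> realization G C q"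
proof (rule ccontr)
  assume "\<not> thesis"
  then have "\<exists>q. (\<forall>i\<in>verts G. cmod (q i - p i) \<le> \<epsilon>) \<and> \<not> realization G C q" if "\<epsilon> > 0" for \<epsilon>
    using \<open>\<And>\<epsilon>. 0 < \<epsilon> \<Longrightarrow> (\<And>q. (\<And>i. i \<in> verts G \<Longrightarrow> cmod (q i - p i) \<le> \<epsilon>) \<Longrightarrow> realization G C q) \<Longrightarrow> thesis\<close> that
    by blast
  then have "\<forall>m. \<exists>q. (\<forall>i\<in>verts G. cmod (q i - p i) \<le> 1 / real (Suc m)) \<and> \<not> realization G C q"
    by simp
  from choice[OF this] obtain q where q: "\<And>m i. i \<in> verts G \<Longrightarrow> cmod (q m i - p i) \<le> 1 / real (Suc m)"
    "\<And>m. \<not> realization G C (q m)" by blast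
  have lim: "(\<lambda>m. q m i) \<longlonglongrightarrow> p i" if "i \<in> verts G" for i
  proof -
    have "(\<lambda>m. q m i - p i) \<longlonglongrightarrow> 0"
      by (rule Lim_null_comparison[OF _ LIMSEQ_inverse_real_of_nat])
         (use q(1)[OF that] in \<open>simp add: inverse_eq_divide\<close>)
    then show ?thesis by (simp add: LIM_zero_iff)
  qed
  have Con_lim: "(\<lambda>m. Con (q m u) (q m v) (q m w)) \<longlonglongrightarrow> Con (p u) (p v) (p w)"
    if "u \<in> verts G" "v \<in> verts G" "w \<in> verts G" for u v w
    unfolding Con_def by (intro tendsto_intros lim that)
  have 1: "eventually (\<lambda>m. \<forall>t\<in>{..<length C}. Con (q m (cyc_nth C t)) (q m (cyc_nth C (t + 1))) (q m (cyc_nth C (t + 2))) > 0) sequentially"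
  proof (rule eventually_ball_finite, simp, intro ballI)
    fix t assume "t \<in> {..<length C}"
    then have "0 < Con (p (cyc_nth C t)) (p (cyc_nth C (t + 1))) (p (cyc_nth C (t + 2)))"
      using R by (simp add: realization_def)
    then show "eventually (\<lambda>m. Con (q m (cyc_nth C t)) (q m (cyc_nth C (t + 1))) (q m (cyc_nth C (t + 2))) > 0) sequentially"
      by (rule order_tendstoD(1)[OF Con_lim[OF cyc_nth_verts cyc_nth_verts cyc_nth_verts]])
  qed
  have 2: "eventually (\<lambda>m. \<forall>t\<in>{..<length C}. \<forall>k\<in>verts G - {cyc_nth C t, cyc_nth C (t + 1)}.
      Con (q m (cyc_nth C t)) (q m k) (q m (cyc_nth C (t + 1))) < 0) sequentially"
  proof (rule eventually_ball_finite, simp, intro ballI, rule eventually_ball_finite, simp add: finite_verts, intro ballI)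
    fix t k assume t: "t \<in> {..<length C}" and k: "k \<in> verts G - {cyc_nth C t, cyc_nth C (t + 1)}"
    have kG: "k \<in> verts G" using k by simp
    have "Con (p (cyc_nth C t)) (p k) (p (cyc_nth C (t + 1))) < 0"
      using R t k by (simp add: realization_def)
    then show "eventually (\<lambda>m. Con (q m (cyc_nth C t)) (q m k) (q m (cyc_nth C (t + 1))) < 0) sequentially"
      by (rule order_tendstoD(2)[OF Con_lim[OF cyc_nth_verts kG cyc_nth_verts]])
  qed
  have 3: "eventually (\<lambda>m. \<forall>e\<in>edges G. \<exists>c. edge_centre G (q m) e c) sequentially"
  proof (rule eventually_ball_finite, rule finite_edges, intro ballI)
    fix e assume e: "e \<in> edges G"
    obtain i j where ij: "i < j" "e = {i, j}" "i \<in> verts G" "j \<in> verts G" by (rule edgeE[OF e])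
    obtain c where "edge_centre G p e c" using R e by (auto simp: realization_def)
    moreover have "p i \<noteq> p j" using inj_onD[OF realization_inj[OF R], of i j] ij by auto
    ultimately show "eventually (\<lambda>m. \<exists>c. edge_centre G (q m) e c) sequentially"
      using edge_centre_eventually[OF finite_verts _ ij(3,4) _ lim] ij(2) by simp
  qed
  have "eventually (\<lambda>m. realization G C (q m)) sequentially"
    using 1 2 3 by eventually_elim (simp add: realization_def)
  then show False using q(2) by (simp add: eventually_sequentially)
qed

lemma realization_polygon:
  assumes R: "realization G C p"
  shows "supporting_polygon (p ` verts G) (p ` set C)"
proof -
  have inj: "inj_on p (verts G)" by (rule realization_inj[OF R])
  have le: "Con (p (cyc_nth C t)) w (p (cyc_nth C (t + 1))) \<le> 0" if t: "t < length C" "w \<in> p ` verts G" for t w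
  proof -
    obtain k where k: "k \<in> verts G" "w = p k" using t(2) by auto
    show ?thesis
    proof (cases "k \<in> {cyc_nth C t, cyc_nth C (t + 1)}")
      case True
      then show ?thesis unfolding k(2) by (auto simp: Con_def)
    next
      case False
      then have "Con (p (cyc_nth C t)) (p k) (p (cyc_nth C (t + 1))) < 0"
        using R t(1) k(1) by (simp add: realization_def)
      then show ?thesis unfolding k(2) by simp
    qed
  qed
  have ne: "p (cyc_nth C t) \<noteq> p (cyc_nth C (t + 1))" if "t < length C" for t
  proof -
    have "t \<noteq> (t + 1) mod length C"
    proof (cases "t + 1 = length C")
      case True
      then show ?thesis using outer_cycle(1) by simp
    next
      case False
      then show ?thesis using that by simp
    qed
    moreover have "(t + 1) mod length C < length C" by (rule mod_less_divisor) (use that in linarith)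
    ultimately have "cyc_nth C t \<noteq> cyc_nth C (t + 1)"
      using that outer_cycle(2) by (simp add: cyc_nth_def nth_eq_iff_index_eq)
    then show ?thesis using inj_onD[OF inj _ cyc_nth_verts cyc_nth_verts] by blast
  qed
  show ?thesis
    unfolding supporting_polygon_def
  proof (intro conjI ballI)
    show "p ` set C \<subseteq> p ` verts G" using outer_cycle(3) by blast
    fix u assume "u \<in> p ` set C"
    then obtain t where t: "t < length C" "u = p (cyc_nth C t)"
      by (auto simp: in_set_conv_nth cyc_nth_def)
    show "\<exists>v\<in>p ` set C. v \<noteq> u \<and> (\<forall>w\<in>p ` verts G. Con u w v \<le> 0)"
      by (rule bexI[of _ "p (cyc_nth C (t + 1))"]) (use t ne[OF t(1)] le[OF t(1)] cyc_nth_in in auto)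
    define t' where "t' = (t + length C - 1) mod length C"
    have t': "t' < length C" unfolding t'_def by (rule mod_less_divisor) (use t(1) in linarith)
    have "(t' + 1) mod length C = t"
    proof (cases "t = 0")
      case True
      then show ?thesis using t(1) by (simp add: t'_def)
    next
      case False
      then have "t + length C - 1 = (t - 1) + length C" by simp
      then have "t' = (t - 1) mod length C" by (simp only: t'_def mod_add_self2)
      then have "t' = t - 1" using t(1) by simp
      then show ?thesis using False t(1) by simp
    qed
    then have "cyc_nth C (t' + 1) = cyc_nth C t" using t(1) by (simp add: cyc_nth_def)
    then show "\<exists>v\<in>p ` set C. v \<noteq> u \<and> (\<forall>w\<in>p ` verts G. Con v w u \<le> 0)"
      by (intro bexI[of _ "p (cyc_nth C t')"]) (use t(2) ne[OF t'] le[OF t'] cyc_nth_in in auto)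
  qed
qed

lemma realization_delaunay_polygon:
  assumes R: "realization G C p"
  shows "delaunay_polygon (p ` verts G) ((`) p ` edges G) (p ` set C)"
proof
  have inj: "inj_on p (verts G)" by (rule realization_inj[OF R])
  show "finite (p ` verts G)" using finite_verts by simp
  show "supporting_polygon (p ` verts G) (p ` set C)" by (rule realization_polygon[OF R])
  show "p ` set C \<noteq> {}" using outer_cycle(1) by auto
  fix e' assume "e' \<in> (`) p ` edges G"
  then obtain e where e: "e \<in> edges G" "e' = p ` e" by auto
  have eG: "e \<subseteq> verts G" by (rule edge_subset[OF e(1)])
  show "e' \<subseteq> p ` verts G" using eG e(2) by blast
  show "card e' = 2" using edge_card[OF e(1)] card_image[OF inj_on_subset[OF inj eG]] e(2) by simp
  obtain c where c: "edge_centre G p e c" using R e(1) by (auto simp: realization_def)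
  have "e \<noteq> {}" using edge_card[OF e(1)] by auto
  then obtain i where i: "i \<in> e" by auto
  have on: "cmod (p j - c) = cmod (p i - c)" if "j \<in> e" for j using c i that unfolding edge_centre_def by blast
  have off: "cmod (p i - c) < cmod (p k - c)" if "k \<in> verts G" "k \<notin> e" for k
    using c i that unfolding edge_centre_def by blast
  have "cmod (p i - c) \<le> cmod (p k - c)" if "k \<in> verts G" for k
    using on[of k] off[OF that] by (cases "k \<in> e") auto
  then have "strictly_empty_circle (p ` verts G) e' c (cmod (p i - c))"
    unfolding strictly_empty_circle_def empty_circle_def e(2) using on off by auto
  then show "\<exists>c r. strictly_empty_circle (p ` verts G) e' c r" by blast
next
  have inj: "inj_on p (verts G)" by (rule realization_inj[OF R])
  have "card (p ` verts G) = card (verts G)" using inj by (rule card_image)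
  moreover have "card (p ` set C) = length C"
    using card_image[OF inj_on_subset[OF inj outer_cycle(3)]] distinct_card[OF outer_cycle(2)] by simp
  moreover have "card ((`) p ` edges G) = card (edges G)"
  proof (rule card_image, rule inj_onI)
    fix e f assume "e \<in> edges G" "f \<in> edges G" "p ` e = p ` f"
    then show "e = f" using inj_on_image_eq_iff[OF inj edge_subset edge_subset] by blast
  qed
  ultimately show "3 * card (p ` verts G) \<le> card ((`) p ` edges G) + card (p ` set C) + 3"
    using card_edges_lower by simp
  let ?a = "p (cyc_nth C 0)" and ?b = "p (cyc_nth C 1)" and ?c = "p (cyc_nth C 2)"
  have "\<forall>t<length C. Con (p (cyc_nth C t)) (p (cyc_nth C (t + 1))) (p (cyc_nth C (t + 2))) > 0"
    using R unfolding realization_def by (elim conjE)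
  moreover have "0 < length C" using outer_cycle(1) by linarith
  ultimately have pos: "Con ?a ?b ?c > 0" by (metis add_0)
  have nc: "\<not> collinear {?a, ?b, ?c}"
  proof
    assume "collinear {?a, ?b, ?c}"
    then consider "?a = ?c" | u where "?b = u *\<^sub>R ?a + (1 - u) *\<^sub>R ?c"
      unfolding collinear_3_expand by blast
    then have "Con ?a ?b ?c = 0"
    proof cases
      case 1 then show ?thesis by (simp add: Con_def)
    next
      case 2 show ?thesis unfolding 2 Con_def by (simp add: algebra_simps)
    qed
    then show False using pos by simp
  qed
  then have "card {?a, ?b, ?c} = 3" "\<not> affine_dependent {?a, ?b, ?c}"
    unfolding collinear_3_eq_affine_dependent by auto
  then have "interior (convex hull {?a, ?b, ?c}) \<noteq> {}"
    using interior_convex_hull_eq_empty[of "{?a, ?b, ?c}"] by simp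
  moreover have "convex hull {?a, ?b, ?c} \<subseteq> convex hull (p ` verts G)"
    using cyc_nth_verts by (intro hull_mono) auto
  ultimately show "interior (convex hull (p ` verts G)) \<noteq> {}"
    using interior_mono by blast
qed

lemma realization_isomorphic:
  assumes "realization G C p" "realization G C q"
  shows "isomorphic (straight_line_graph (p ` verts G) ((`) p ` edges G))
    (straight_line_graph (q ` verts G) ((`) q ` edges G))"
proof -
  define \<phi> where "\<phi> = q \<circ> the_inv_into (verts G) p"
  have inj: "inj_on p (verts G)" "inj_on q (verts G)" using realization_inj assms by auto
  have \<phi>: "\<phi> (p i) = q i" if "i \<in> verts G" for i
    using that inj by (simp add: \<phi>_def the_inv_into_f_f)
  have "bij_betw \<phi> (p ` verts G) (q ` verts G)"
    unfolding \<phi>_def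
    by (rule bij_betw_trans[OF bij_betw_the_inv_into[OF inj_on_imp_bij_betw[OF inj(1)]] inj_on_imp_bij_betw[OF inj(2)]])
  moreover have mem: "{r u, r v} \<in> (`) r ` edges G \<longleftrightarrow> {u, v} \<in> edges G"
    if "inj_on r (verts G)" "u \<in> verts G" "v \<in> verts G" for r :: "'a \<Rightarrow> complex" and u v
  proof
    assume "{r u, r v} \<in> (`) r ` edges G"
    then obtain e where e: "e \<in> edges G" "r ` {u, v} = r ` e" by auto
    then have "{u, v} = e" using inj_on_image_eq_iff[OF that(1) _ edge_subset[OF e(1)], of "{u, v}"] that by auto
    then show "{u, v} \<in> edges G" using e(1) by simp
  next
    assume "{u, v} \<in> edges G"
    then have "r ` {u, v} \<in> (`) r ` edges G" by (rule imageI)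
    then show "{r u, r v} \<in> (`) r ` edges G" by simp
  qed
  have "{x, y} \<in> (`) p ` edges G \<longleftrightarrow> {\<phi> x, \<phi> y} \<in> (`) q ` edges G"
    if xy: "x \<in> p ` verts G" "y \<in> p ` verts G" for x y
  proof -
    obtain u where u: "u \<in> verts G" "x = p u" using xy(1) by blast
    obtain v where v: "v \<in> verts G" "y = p v" using xy(2) by blast
    show ?thesis
      using mem[OF inj(1) u(1) v(1)] mem[OF inj(2) u(1) v(1)] \<phi>[OF u(1)] \<phi>[OF v(1)]
      unfolding u(2) v(2) by simp
  qed
  ultimately show ?thesis unfolding isomorphic_def graph_iso_def by (intro exI[of _ \<phi>]) simp
qed

lemma outer_verts_subset: "outer_verts G \<subseteq> set C"
proof
  fix v assume v: "v \<in> outer_verts G"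
  then have vG: "v \<in> verts G" and "place G v \<in> (\<Union>e\<in>cycle_edges C. curve G e)"
    using outer_cycle(5) by (auto simp: outer_verts_def)
  then obtain e where e: "e \<in> cycle_edges C" "place G v \<in> curve G e" by auto
  have eG: "e \<in> edges G" using e(1) outer_cycle(4) by blast
  have "place G v \<in> place G ` e" using curve_place[OF eG] e(2) vG by blast
  then have "v \<in> e" using inj_on_image_mem_iff[OF inj_place vG edge_subset[OF eG]] by simp
  then show "v \<in> set C" using e(1) cyc_nth_in by (auto simp: cycle_edges_def)
qed

end

theorem theorem13:
  fixes G :: "nat plane_graph" and n :: nat and C :: "nat list"
    and Q :: "nat assignment" and \<beta> :: real
  assumes "is_triangulation G"
    and "verts G = {1..n}"
    and "bounded_by_cycle G (outer_face G) C"
    and "clockwise_cycle G C"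
    and "delaunay_realizable_outer G"
    and "solves_Const G C Q"
    and "\<beta> > 0"
  shows "\<exists>S. solves_Const G C S \<and>
    (\<exists>r. (\<forall>i\<in>{1..n}. r i \<ge> \<beta>) \<and>
      (\<forall>P'. (\<forall>i\<in>{1..n}. P' i \<in> cball (point S i) (r i)) \<longrightarrow>
        delaunay_triangulations (P' ` {1..n}) \<noteq> {} \<and>
        (\<forall>T'\<in>delaunay_triangulations (P' ` {1..n}).
          (\<forall>T\<in>delaunay_triangulations (point S ` {1..n}). isomorphic T' T) \<and>
          (\<forall>i\<in>outer_verts G. P' i \<in> frontier (outer_face T')))))"
proof -
  interpret cycle_bounded_triangulation G C by unfold_locales (fact assms)+
  have V: "verts G = {1..n}" by fact
  have R: "realization G C (point Q)" using realization_iff[OF plane] assms(6) by blast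
  obtain \<epsilon> where \<epsilon>: "\<epsilon> > 0" "\<And>q. (\<And>i. i \<in> verts G \<Longrightarrow> cmod (q i - point Q i) \<le> \<epsilon>) \<Longrightarrow> realization G C q"
    by (rule realization_open[OF R]) blast
  define k where "k = \<beta> / \<epsilon>"
  have k: "k > 0" using \<epsilon>(1) assms(7) by (simp add: k_def)
  define p where "p = (\<lambda>i. of_real k * point Q i)"
  have Rp: "realization G C p" unfolding p_def by (rule realization_scale[OF R k])
  then obtain S where S: "solves_Const G C S" "point S = p" using realization_iff[OF plane] by blast
  have dt: "delaunay_triangulations (q ` verts G) = {straight_line_graph (q ` verts G) ((`) q ` edges G)}"
    if "realization G C q" for q
    using delaunay_polygon.delaunay_triangulations_eq[OF realization_delaunay_polygon[OF that]] .
  have near: "realization G C P'" if P': "\<forall>i\<in>{1..n}. P' i \<in> cball (point S i) \<beta>" for P'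
  proof -
    have "realization G C (\<lambda>i. P' i / of_real k)"
    proof (rule \<epsilon>(2))
      fix i assume "i \<in> verts G"
      then have "cmod (P' i - p i) \<le> \<beta>"
        using P' V S(2) by (auto simp: dist_norm norm_minus_commute)
      then have "cmod (P' i - p i) / k \<le> \<epsilon>" using k \<epsilon>(1) by (simp add: k_def field_simps)
      moreover have "P' i / of_real k - point Q i = (P' i - p i) / of_real k"
        using k by (simp add: p_def field_simps)
      ultimately show "cmod (P' i / of_real k - point Q i) \<le> \<epsilon>"
        using k by (simp add: norm_divide)
    qed
    then have "realization G C (\<lambda>i. of_real k * (P' i / of_real k))" by (rule realization_scale[OF _ k])
    then show ?thesis using k by simp
  qed
  have outer: "P' i \<in> frontier (outer_face T')"
    if RP: "realization G C P'" and "T' \<in> delaunay_triangulations (P' ` verts G)" "i \<in> outer_verts G" for P' T' i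
  proof -
    have "P' i \<in> frontier (convex hull (P' ` verts G))"
      using that(3) outer_verts_subset
      by (intro delaunay_polygon.polygon_frontier[OF realization_delaunay_polygon[OF RP]]) auto
    moreover have "frontier (outer_face T') = frontier (convex hull (P' ` verts G))"
      using that(2) unfolding delaunay_triangulations_def by blast
    ultimately show ?thesis by simp
  qed
  show ?thesis
  proof (intro exI[of _ S] exI[of _ "\<lambda>_. \<beta>"] conjI allI impI S(1))
    fix P' assume "\<forall>i\<in>{1..n}. P' i \<in> cball (point S i) \<beta>"
    then have RP: "realization G C P'" by (rule near)
    show "delaunay_triangulations (P' ` {1..n}) \<noteq> {}" using dt[OF RP] V by simp
    show "\<forall>T'\<in>delaunay_triangulations (P' ` {1..n}).
        (\<forall>T\<in>delaunay_triangulations (point S ` {1..n}). isomorphic T' T) \<and>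
        (\<forall>i\<in>outer_verts G. P' i \<in> frontier (outer_face T'))"
      using dt[OF RP] dt[OF Rp] realization_isomorphic[OF RP Rp] outer[OF RP] V S(2) by simp
  qed simp
qed

end
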